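(* Let $n\ge 1$ be an integer, let $\sigma$ be a real number with $0<\sigma<n/2$, let $k$ be an integer with $0\le k\le n-1$, and let $\mathbb{R}^k$ be a $k$-dimensional linear subspace of $\mathbb{R}^n$ (with $\mathbb{R}^0=\{0\}$). Let $u\in L^{\frac{n+2\sigma}{n-2\sigma}}_{\mathrm{loc}}(\mathbb{R}^n)\cap C(\mathbb{R}^n\setminus\mathbb{R}^k)$ be a positive solution of $$u(x)=\int_{\mathbb{R}^n}\frac{u(y)^{\frac{n+2\sigma}{n-2\sigma}}}{|x-y|^{n-2\sigma}}\,dy,\qquad x\in\mathbb{R}^n\setminus\mathbb{R}^k.$$ Suppose there exists $x_0\in\mathbb{R}^k$ such that $\limsup_{x\to x_0}u(x)=\infty$. Then $$u(x',x'')=u(x',\tilde x'')$$ for all $x'\in\mathbb{R}^k$ and all $x'',\tilde x''\in\mathbb{R}^{n-k}$ with $|x''|=|\tilde x''|$ (and $x''\neq 0$). In particular, if $k=0$, i.e. $\mathbb{R}^k=\{0\}$, and the origin is a non-removable singularity, then $u$ is radially symmetric and monotonically decreasing about the origin.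
   Context: Points of $\mathbb{R}^n$ are written $(x',x'')$ with $x'\in\mathbb{R}^k$ and $x''\in\mathbb{R}^{n-k}$, where $\mathbb{R}^{n-k}=(\mathbb{R}^k)^\perp$ is the orthogonal complement of $\mathbb{R}^k$. The limsup is taken over $x\in\mathbb{R}^n\setminus\mathbb{R}^k$. The origin is a removable singularity if $u$ can be extended to a continuous positive solution of the integral equation on the whole $\mathbb{R}^n$, and non-removable otherwise. "Monotonically decreasing about the origin" means that $u$, as a function of $|x|$, is monotonically decreasing. *)

theory Defs
  imports "HOL-Analysis.Analysis"
begin

text \<open>The dimension \<open>n\<close> is \<open>DIM('a)\<close>. A function on the complement of a proper subspace is
  modelled by a total function. Its values on the subspace, a Lebesgue null set, are irrelevant:
  hence the complete measure \<^const>\<open>lebesgue\<close> rather than \<^const>\<open>lborel\<close> throughout.\<close>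

definition Lp_loc :: "real \<Rightarrow> ('a::euclidean_space \<Rightarrow> real) set" where
  "Lp_loc p = {u. u \<in> borel_measurable lebesgue \<and>
     (\<forall>K. compact K \<longrightarrow> set_integrable lebesgue K (\<lambda>x. \<bar>u x\<bar> powr p))}"

text \<open>The integral is required to exist. The integrand takes the value \<open>0\<close> at \<open>y = x\<close>,
  a single point.\<close>

definition positive_solution_on :: "'a::euclidean_space set \<Rightarrow> real \<Rightarrow> ('a \<Rightarrow> real) \<Rightarrow> bool" where
  "positive_solution_on X \<sigma> u \<longleftrightarrow>
     (\<forall>x\<in>X. 0 < u x \<and>
        has_bochner_integral lebesgue
          (\<lambda>y. u y powr ((real DIM('a) + 2 * \<sigma>) / (real DIM('a) - 2 * \<sigma>))
                 / norm (x - y) powr (real DIM('a) - 2 * \<sigma>))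
          (u x))"

definition removable_at_origin :: "real \<Rightarrow> ('a::euclidean_space \<Rightarrow> real) \<Rightarrow> bool" where
  "removable_at_origin \<sigma> u \<longleftrightarrow>
     (\<exists>v. (\<forall>x. x \<noteq> 0 \<longrightarrow> v x = u x) \<and> continuous_on UNIV v \<and> positive_solution_on UNIV \<sigma> v)"

definition radially_decreasing :: "('a::euclidean_space \<Rightarrow> real) \<Rightarrow> bool" where
  "radially_decreasing u \<longleftrightarrow>
     (\<exists>f :: real \<Rightarrow> real. (\<forall>x. x \<noteq> 0 \<longrightarrow> u x = f (norm x)) \<and> antimono_on {0<..} f)"

end

(* Write alpha = n - 2 sigma and let v be the Kelvin transform of u in the sphere of radius r about a
   centre x off S, with r < dist(x, S). Inside this ball the equation gives
     u - v = int_B (G - H) (u^p - v^p),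
   where G is the kernel |y - z|^-alpha and 0 < H < G. Since u is bounded on the ball, taking the
   supremum of u - v shows that u <= v as soon as the set {u > v} is small, because then the integral
   of G over this set is small. This holds for small r. If it holds for some r, then the inequality
   is strict, as u is unbounded outside the ball, so {u > v} remains small for nearby radii. Hence
   the admissible radii form an open and closed subset of (0, dist(x, S)), and u <= v for all of them.
   With centre R e and radius R - a, where e is a unit vector orthogonal to S and a > 0, letting R
   tend to infinity yields u(reflection of y) <= u(y) in the half space y . e < a; the symmetry follows
   for a -> 0 and the monotonicity directly. If the limsup at the origin is finite, dominated
   convergence extends the equation to the origin. *)

theory Submission
  imports Defs "HOL-Real_Asymp.Real_Asymp"
begin

text \<open>The delicate places of a moving sphere argument are the sphere itself, where
  \<open>u\<close> and \<open>v\<close> agree; the centre, whose image is at infinity; and the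
  points whose image lies on S, where nothing is known about \<open>v\<close>. Measuring the set {u
  > v} deals with all three at once: they are null sets, and the supremum estimate uses only that
  the measure is small, so no gap between \<open>u\<close> and \<open>v\<close> near these places
  has to be established.

  Spheres come before planes because the comparison then takes place in a ball on which
  \<open>u\<close> is bounded, and it starts from small radii. In a half space it would have to
  start from the behaviour of \<open>u\<close> at infinity.

  The exponent is the one for which the equation is conformally invariant:
  \<open>\<alpha> * p = 2 * n - \<alpha>\<close>. The Jacobian of the inversion is then absorbed by
  the weight in \<open>v\<close>, which yields the formula for u - v.\<close>

section \<open>Change of variables for the inversion in a sphere\<close>

text \<open>The change of variables formula of the library is for \<open>real ^ 'n\<close> with a well-ordered finite
  index type; indexing by the canonical basis transfers it to an arbitrary Euclidean space.\<close>

typedef (overloaded) ('a::euclidean_space) basis_index = "Basis :: 'a set"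
  by (rule nonempty_Basis[unfolded ex_in_conv[symmetric]])

instantiation basis_index :: (euclidean_space) "{finite, wellorder}"
begin

text \<open>The change of variables theorem asks for a well-order on the index type. Any injection
  of \<open>Basis\<close> into the naturals pulls one back, so it does not matter which one
  \<open>SOME\<close> picks.\<close>

definition basis_rank :: "'a basis_index \<Rightarrow> nat" where
  "basis_rank i = (SOME f. inj_on f (Basis :: 'a set)) (Rep_basis_index i)"

definition less_eq_basis_index :: "'a basis_index \<Rightarrow> 'a basis_index \<Rightarrow> bool" where
  "less_eq_basis_index i j \<longleftrightarrow> basis_rank i \<le> basis_rank j"

definition less_basis_index :: "'a basis_index \<Rightarrow> 'a basis_index \<Rightarrow> bool" where
  "less_basis_index i j \<longleftrightarrow> basis_rank i < basis_rank j"

lemma basis_rank_eq: "basis_rank (i :: 'a basis_index) = basis_rank j \<longleftrightarrow> i = j"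
proof -
  have "\<exists>f :: 'a \<Rightarrow> nat. inj_on f Basis"
    using countable_finite[OF finite_Basis] unfolding countable_def by blast
  then have "inj_on (SOME f :: 'a \<Rightarrow> nat. inj_on f Basis) Basis"
    by (rule someI_ex)
  then show ?thesis
    unfolding basis_rank_def
    by (metis Rep_basis_index Rep_basis_index_inject inj_on_eq_iff)
qed

instance
proof
  show "finite (UNIV :: 'a basis_index set)"
    by (metis finite_Basis finite_imageI type_definition.Abs_image type_definition_basis_index)
next
  fix P :: "'a basis_index \<Rightarrow> bool" and a
  assume step: "\<And>x. (\<And>y. y < x \<Longrightarrow> P y) \<Longrightarrow> P x"
  show "P a"
    by (rule measure_induct_rule[of basis_rank], rule step) (simp only: less_basis_index_def)
qed (simp_all add: less_eq_basis_index_def less_basis_index_def less_le_not_le linear flip: basis_rank_eq)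

end

lemma bij_betw_Rep_basis_index: "bij_betw Rep_basis_index UNIV (Basis :: 'a::euclidean_space set)"
  by (metis bij_betw_def inj_def Rep_basis_index_inject type_definition.Rep_range
      type_definition_basis_index)

lemma card_basis_index: "CARD('a::euclidean_space basis_index) = DIM('a)"
  using bij_betw_same_card[OF bij_betw_Rep_basis_index] .

definition of_coords :: "real ^ ('a::euclidean_space basis_index) \<Rightarrow> 'a" where
  "of_coords v = (\<Sum>i\<in>UNIV. v $ i *\<^sub>R Rep_basis_index i)"

lemma of_coords_eq: "of_coords v = (\<Sum>b\<in>Basis. (v $ Abs_basis_index b) *\<^sub>R (b :: 'a::euclidean_space))"
  unfolding of_coords_def
  by (subst sum.reindex_bij_betw[OF bij_betw_Rep_basis_index, symmetric])
     (simp add: Rep_basis_index_inverse)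

lemma of_coords_inner:
  assumes "b \<in> Basis"
  shows "of_coords v \<bullet> b = v $ Abs_basis_index (b :: 'a::euclidean_space)"
  unfolding of_coords_eq using assms by simp

lemma linear_of_coords: "linear of_coords"
  by (rule linearI) (auto simp: of_coords_def scaleR_add_left sum.distrib scaleR_sum_right)

lemma norm_of_coords: "norm (of_coords v :: 'a::euclidean_space) = norm v"
proof -
  have "(norm (of_coords v))\<^sup>2 = (\<Sum>b\<in>Basis. (v $ Abs_basis_index (b :: 'a))\<^sup>2)"
    unfolding power2_norm_eq_inner
    by (subst euclidean_inner) (simp add: of_coords_inner power2_eq_square)
  also have "\<dots> = (\<Sum>i\<in>UNIV. (v $ i)\<^sup>2)"
    by (subst sum.reindex_bij_betw[OF bij_betw_Rep_basis_index, symmetric])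
       (simp add: Rep_basis_index_inverse)
  also have "\<dots> = (norm v)\<^sup>2"
    unfolding power2_norm_eq_inner inner_vec_def by (simp add: power2_eq_square)
  finally show ?thesis
    by (simp add: power2_eq_iff_nonneg)
qed

lemma borel_measurable_of_coords [measurable]: "of_coords \<in> borel_measurable borel"
  by (intro borel_measurable_continuous_onI linear_continuous_on)
     (rule linear_conv_bounded_linear[THEN iffD1, OF linear_of_coords])

text \<open>The preimage of a box is a box with the same side lengths, only indexed differently, and
  Lebesgue measure is determined by its values on boxes.\<close>

lemma lborel_eq_distr_of_coords: "(lborel :: 'a::euclidean_space measure) = distr lborel borel of_coords"
proof (rule lborel_eqI)
  fix l u :: 'a
  assume le: "\<And>b. b \<in> Basis \<Longrightarrow> l \<bullet> b \<le> u \<bullet> b"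
  let ?c = "\<lambda>x :: 'a. \<chi> i. x \<bullet> Rep_basis_index i"
  have eq: "of_coords -` box l u = box (?c l) (?c u)"
  proof -
    have "(\<forall>b\<in>Basis. P b (v $ Abs_basis_index b)) \<longleftrightarrow> (\<forall>i. P (Rep_basis_index i) (v $ i))"
      for P :: "'a \<Rightarrow> real \<Rightarrow> bool" and v
      by (metis Abs_basis_index_inverse Rep_basis_index Rep_basis_index_inverse)
    from this[of "\<lambda>b t. l \<bullet> b < t \<and> t < u \<bullet> b"] show ?thesis
      by (auto simp: mem_box(1)[where 'a='a] mem_box_cart of_coords_inner)
  qed
  have "emeasure lborel (box (?c l) (?c u)) = (\<Prod>b\<in>Basis. (?c u - ?c l) \<bullet> b)"
    using le[OF Rep_basis_index]
    by (subst emeasure_lborel_box_eq) (auto simp: Basis_vec_def inner_axis)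
  also have "(\<Prod>b\<in>Basis. (?c u - ?c l) \<bullet> b) = (\<Prod>i\<in>UNIV. (?c u - ?c l) $ i)"
    by (subst prod.reindex_bij_betw[of "\<lambda>i. axis i 1" UNIV, symmetric])
       (auto simp: Basis_vec_def inner_axis bij_betw_def inj_def axis_eq_axis)
  also have "\<dots> = (\<Prod>b\<in>Basis. (u - l) \<bullet> b)"
    by (subst prod.reindex_bij_betw[OF bij_betw_Rep_basis_index, symmetric])
       (simp add: inner_diff_left)
  finally show "emeasure (distr lborel borel of_coords) (box l u) = (\<Prod>b\<in>Basis. (u - l) \<bullet> b)"
    by (simp add: emeasure_distr eq)
qed simp

section \<open>Inversion in a sphere: derivative, Jacobian, transformation of integrals\<close>

definition inversion :: "real \<Rightarrow> 'a::real_inner \<Rightarrow> 'a" where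
  "inversion r z = (r / norm z)\<^sup>2 *\<^sub>R z"

lemma inversion_0 [simp]: "inversion r 0 = 0"
  by (simp add: inversion_def)

lemma norm_inversion: "norm (inversion r z) = r\<^sup>2 / norm z"
  by (cases "z = 0") (simp_all add: inversion_def power2_eq_square)

text \<open>Division by zero sends the centre to itself, so the inversion is an involution of the
  whole space and no point at infinity has to be added.\<close>

lemma inversion_inversion [simp]:
  assumes "r \<noteq> 0"
  shows "inversion r (inversion r z) = z"
proof (cases "z = 0")
  case False
  then have "r / (r\<^sup>2 / norm z) * (r / norm z) = 1"
    using assms by (simp add: power2_eq_square)
  then have "(r / (r\<^sup>2 / norm z))\<^sup>2 * (r / norm z)\<^sup>2 = 1"
    by (metis power_mult_distrib power_one)
  then show ?thesis
    unfolding inversion_def[of r "inversion r z"] norm_inversion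
    by (simp add: inversion_def[of r z])
qed simp

lemma inversion_eq_0_iff [simp]: "r \<noteq> 0 \<Longrightarrow> inversion r z = 0 \<longleftrightarrow> z = 0"
  by (auto simp: inversion_def)

lemma borel_measurable_inversion [measurable]:
  "inversion r \<in> borel_measurable (borel :: 'a::euclidean_space measure)"
  unfolding inversion_def by measurable

text \<open>Up to the factor \<open>(r / norm z)\<^sup>2\<close> the derivative is the reflection in
  the hyperplane orthogonal to \<open>z\<close>. In this form its determinant is, up to sign, that
  of a scaling.\<close>

lemma has_derivative_inversion:
  fixes z :: "'a::real_inner"
  assumes "z \<noteq> 0"
  shows "(inversion r has_derivative
           (\<lambda>h. (r / norm z)\<^sup>2 *\<^sub>R (h - (2 * (z \<bullet> h) / (z \<bullet> z)) *\<^sub>R z))) (at z within A)"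
proof -
  have *: "inversion r = (\<lambda>z :: 'a. (r\<^sup>2 / (z \<bullet> z)) *\<^sub>R z)"
    by (auto simp: inversion_def power_divide power2_norm_eq_inner)
  have "((\<lambda>z. (r\<^sup>2 / (z \<bullet> z)) *\<^sub>R z) has_derivative
      (\<lambda>h. (r\<^sup>2 / (z \<bullet> z)) *\<^sub>R h + (- r\<^sup>2 * (inverse (z \<bullet> z) * (z \<bullet> h + h \<bullet> z) * inverse (z \<bullet> z))) *\<^sub>R z)) (at z within A)"
    unfolding divide_inverse using assms
    by (auto intro!: derivative_eq_intros simp: fun_eq_iff)
  also have "(\<lambda>h. (r\<^sup>2 / (z \<bullet> z)) *\<^sub>R h + (- r\<^sup>2 * (inverse (z \<bullet> z) * (z \<bullet> h + h \<bullet> z) * inverse (z \<bullet> z))) *\<^sub>R z)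
      = (\<lambda>h. (r / norm z)\<^sup>2 *\<^sub>R (h - (2 * (z \<bullet> h) / (z \<bullet> z)) *\<^sub>R z))"
    by (simp add: fun_eq_iff scaleR_diff_right inner_commute divide_inverse mult.assoc
        mult.left_commute power_mult_distrib power_inverse flip: power2_norm_eq_inner)
  finally show ?thesis unfolding * .
qed

lemma orthogonal_transformation_hyperplane_reflection:
  fixes z :: "'a::euclidean_space"
  shows "orthogonal_transformation (\<lambda>h. h - (2 * (z \<bullet> h) / (z \<bullet> z)) *\<^sub>R z)"
proof (cases "z = 0")
  case True
  then show ?thesis by (simp add: orthogonal_transformation_def linear_iff)
next
  case False
  then show ?thesis
    unfolding orthogonal_transformation_def
    by (auto simp: linear_iff algebra_simps inner_simps inner_commute add_divide_distrib)
qed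

lemma nn_integral_inversion_cart:
  fixes F :: "real ^ 'n::{finite,wellorder} \<Rightarrow> ennreal"
  assumes [measurable]: "F \<in> borel_measurable borel" and r: "0 < r"
  shows "(\<integral>\<^sup>+z. F z \<partial>lborel) = (\<integral>\<^sup>+z. ennreal ((r / norm z) ^ (2 * CARD('n))) * F (inversion r z) \<partial>lborel)"
proof -
  let ?d = "\<lambda>z :: real^'n::_. (r / norm z) ^ (2 * CARD('n))"
  let ?g' = "\<lambda>z h :: real^'n::_. (r / norm z)\<^sup>2 *\<^sub>R (h - (2 * (z \<bullet> h) / (z \<bullet> z)) *\<^sub>R z)"
  have det: "\<bar>det (matrix (?g' z))\<bar> = ?d z" for z
  proof -
    have "matrix (?g' z) = matrix ((*\<^sub>R) ((r / norm z)\<^sup>2)) ** matrix (\<lambda>h. h - (2 * (z \<bullet> h) / (z \<bullet> z)) *\<^sub>R z)"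
      by (subst matrix_compose[symmetric])
         (auto simp: o_def linear_iff algebra_simps add_divide_distrib orthogonal_transformation_hyperplane_reflection
           orthogonal_transformation_linear)
    then show ?thesis
      using orthogonal_transformation_hyperplane_reflection[of z]
      by (simp add: det_mul abs_mult power_mult)
  qed
  have *: "emeasure lborel (inversion r ` S) = (\<integral>\<^sup>+z. ennreal (?d z) * indicator S z \<partial>lborel)"
    if S: "S \<in> sets borel" "0 \<notin> S" for S
  proof -
    \<comment> \<open>The image under an involution is a preimage, hence Borel.\<close>
    have im: "inversion r ` S = inversion r -` S \<inter> space borel"
    proof (intro equalityI subsetI)
      fix x assume "x \<in> inversion r -` S \<inter> space borel"
      then show "x \<in> inversion r ` S"
        using r by (intro image_eqI[of _ _ "inversion r x"]) auto
    qed (use r in auto)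
    have imb [measurable]: "inversion r ` S \<in> sets borel"
      unfolding im using S(1) by measurable
    have char: "inversion r ` S \<in> lmeasurable \<and> measure lebesgue (inversion r ` S) = m
        \<longleftrightarrow> (?d has_integral m) S" for m
    proof -
      have "S \<in> sets lebesgue" using S(1) by simp
      moreover have "(inversion r has_derivative ?g' x) (at x within S)" if "x \<in> S" for x
        using that S(2) by (intro has_derivative_inversion) auto
      moreover have "inj_on (inversion r) S"
        using r by (intro inj_on_inverseI[of _ "inversion r"]) simp
      ultimately show ?thesis
        using has_measure_differentiable_image[of S "inversion r" ?g' m] by (simp only: det)
    qed
    show ?thesis
    proof (cases "inversion r ` S \<in> lmeasurable")
      case True
      then have "(?d has_integral (measure lebesgue (inversion r ` S))) S"
        using char by blast
      from nn_integral_has_integral_lebesgue'[OF _ this]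
      have "(\<integral>\<^sup>+z. ennreal (?d z) * indicator S z \<partial>lborel) = ennreal (measure lebesgue (inversion r ` S))"
        using r by simp
      moreover have "emeasure lborel (inversion r ` S) = emeasure lebesgue (inversion r ` S)"
        using imb by simp
      ultimately show ?thesis
        using emeasure_eq_measure2[OF True] by metis
    next
      \<comment> \<open>The image now has infinite measure. By \<open>char\<close>,
        \<open>?d\<close> is not integrable over \<open>S\<close>, so both sides are
        infinite.\<close>
      case False
      have "(\<integral>\<^sup>+z. ennreal (?d z) * indicator S z \<partial>lborel) = \<infinity>"
      proof (rule ccontr)
        assume "(\<integral>\<^sup>+z. ennreal (?d z) * indicator S z \<partial>lborel) \<noteq> \<infinity>"
        then have "(\<integral>\<^sup>+z. ennreal (?d z * indicator S z) \<partial>lborel) < \<infinity>"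
          by (simp add: ennreal_mult' ennreal_indicator top.not_eq_extremum)
        then have "integrable lborel (\<lambda>z. ?d z * indicator S z)"
          using S r by (intro integrableI_nonneg) auto
        then have "set_integrable lborel S ?d"
          by (simp add: set_integrable_def mult.commute)
        from set_borel_integral_eq_integral(1)[OF this] show False
          using char False by blast
      qed
      with False show ?thesis
        by (auto simp: fmeasurable_def not_less top_unique)
    qed
  qed
  \<comment> \<open>The formula for sets says that the inversion pushes the weighted measure forward
    to Lebesgue measure, which covers all nonnegative integrands at once. The centre, where there is
    no derivative, is removed as a null set.\<close>
  have "lborel = distr (density lborel (\<lambda>z. ennreal (?d z))) borel (inversion r)"
  proof (rule measure_eqI)
    fix A :: "(real^'n::_) set"
    assume "A \<in> sets lborel"
    then have [measurable]: "A \<in> sets borel" by simp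
    have S: "inversion r -` A - {0} \<in> sets borel"
      using measurable_sets[OF borel_measurable_inversion, of A r] by auto
    have im: "inversion r ` (inversion r -` A - {0}) = A - {0}"
    proof (intro equalityI subsetI)
      fix x assume "x \<in> A - {0}"
      then show "x \<in> inversion r ` (inversion r -` A - {0})"
        using r by (intro image_eqI[of _ _ "inversion r x"]) auto
    qed (use r in auto)
    have "emeasure lborel A = emeasure lborel (A - {0})"
      by (rule emeasure_Diff_null_set[symmetric]) (auto intro: finite_imp_null_set_lborel)
    also have "\<dots> = (\<integral>\<^sup>+z. ennreal (?d z) * indicator (inversion r -` A - {0}) z \<partial>lborel)"
      using *[OF S] by (simp add: im)
    also have "\<dots> = (\<integral>\<^sup>+z. ennreal (?d z) * indicator (inversion r -` A) z \<partial>lborel)"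
      by (intro nn_integral_cong) (auto simp: indicator_def)
    also have "\<dots> = emeasure (distr (density lborel (\<lambda>z. ennreal (?d z))) borel (inversion r)) A"
      using measurable_sets[OF borel_measurable_inversion, of A r]
      by (simp add: emeasure_distr emeasure_density)
    finally show "emeasure lborel A = emeasure (distr (density lborel (\<lambda>z. ennreal (?d z))) borel (inversion r)) A" .
  qed simp
  then have "(\<integral>\<^sup>+z. F z \<partial>lborel) = (\<integral>\<^sup>+z. F z \<partial>distr (density lborel (\<lambda>z. ennreal (?d z))) borel (inversion r))"
    by simp
  also have "\<dots> = (\<integral>\<^sup>+z. ennreal (?d z) * F (inversion r z) \<partial>lborel)"
    by (simp add: nn_integral_distr nn_integral_density)
  finally show ?thesis .
qed

lemma nn_integral_inversion:
  fixes F :: "'a::euclidean_space \<Rightarrow> ennreal"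
  assumes [measurable]: "F \<in> borel_measurable borel" and r: "0 < r"
  shows "(\<integral>\<^sup>+z. F z \<partial>lborel) = (\<integral>\<^sup>+z. ennreal ((r / norm z) ^ (2 * DIM('a))) * F (inversion r z) \<partial>lborel)"
proof -
  have "(\<integral>\<^sup>+z. F z \<partial>lborel) = (\<integral>\<^sup>+v. F (of_coords v) \<partial>lborel)"
    by (subst lborel_eq_distr_of_coords) (simp add: nn_integral_distr)
  also have "\<dots> = (\<integral>\<^sup>+v. ennreal ((r / norm v) ^ (2 * DIM('a))) * F (of_coords (inversion r v)) \<partial>lborel)"
    by (subst nn_integral_inversion_cart[OF _ r]) (simp_all add: card_basis_index)
  also have "\<dots> = (\<integral>\<^sup>+v. ennreal ((r / norm (of_coords v)) ^ (2 * DIM('a))) * F (inversion r (of_coords v)) \<partial>lborel)"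
    by (simp add: norm_of_coords inversion_def linear_cmul[OF linear_of_coords])
  also have "\<dots> = (\<integral>\<^sup>+z. ennreal ((r / norm z) ^ (2 * DIM('a))) * F (inversion r z) \<partial>lborel)"
    by (subst (2) lborel_eq_distr_of_coords) (simp add: nn_integral_distr)
  finally show ?thesis .
qed

section \<open>Auxiliary estimates\<close>

lemma nn_integral_lborel_diff:
  fixes F :: "'a::euclidean_space \<Rightarrow> ennreal"
  assumes [measurable]: "F \<in> borel_measurable borel"
  shows "(\<integral>\<^sup>+z. F (x - z) \<partial>lborel) = (\<integral>\<^sup>+z. F z \<partial>lborel)"
proof -
  have "lborel = distr lborel borel (\<lambda>z. x - z)"
    using lborel_affine[of "-1" x] by (simp add: density_1)
  then have "(\<integral>\<^sup>+z. F z \<partial>lborel) = (\<integral>\<^sup>+z. F z \<partial>distr lborel borel (\<lambda>z. x - z))"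
    by simp
  also have "\<dots> = (\<integral>\<^sup>+z. F (x - z) \<partial>lborel)"
    by (simp add: nn_integral_distr)
  finally show ?thesis ..
qed

lemma nn_integral_lborel_translate:
  fixes F :: "'a::euclidean_space \<Rightarrow> ennreal"
  assumes [measurable]: "F \<in> borel_measurable borel"
  shows "(\<integral>\<^sup>+z. F (x + z) \<partial>lborel) = (\<integral>\<^sup>+z. F z \<partial>lborel)"
proof -
  have "(\<integral>\<^sup>+z. F z \<partial>lborel) = (\<integral>\<^sup>+z. F z \<partial>distr lborel borel ((+) x))"
    by (simp add: lborel_distr_plus)
  also have "\<dots> = (\<integral>\<^sup>+z. F (x + z) \<partial>lborel)"
    by (simp add: nn_integral_distr)
  finally show ?thesis ..
qed

lemma borel_ball [measurable]: "ball (x :: 'a::euclidean_space) r \<in> sets borel"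
  by simp

lemma AE_lborel_norm_neq: "AE z in lborel. norm (z :: 'a::euclidean_space) \<noteq> r"
proof -
  have "sphere (0 :: 'a) r \<in> null_sets lborel"
    using negligible_sphere[of "0 :: 'a" r]
    by (simp add: negligible_iff_null_sets null_sets_def)
  then show ?thesis
    by (rule AE_I') auto
qed

text \<open>The weight in \<open>nn_integral_inversion\<close> is positive off the origin, so null
  sets have null preimages. This later discards the points whose image is on the singular
  set.\<close>

lemma AE_inversion_not_in_null_set:
  assumes Z: "Z \<in> null_sets (lborel :: 'a::euclidean_space measure)" and r: "0 < r"
  shows "AE z in lborel. inversion r z \<notin> Z"
proof -
  have [measurable]: "Z \<in> sets borel" using Z by auto
  have "(\<integral>\<^sup>+z. ennreal ((r / norm z) ^ (2 * DIM('a))) * indicator Z (inversion r z) \<partial>lborel)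
      = (\<integral>\<^sup>+z. indicator Z z \<partial>lborel)"
    by (rule nn_integral_inversion[OF _ r, symmetric]) simp
  also have "\<dots> = 0" using Z by auto
  finally have "AE z in lborel. ennreal ((r / norm z) ^ (2 * DIM('a))) * indicator Z (inversion r z) = 0"
    by (subst (asm) nn_integral_0_iff_AE) auto
  with AE_lborel_norm_neq[of 0] show ?thesis
    by eventually_elim (use r in \<open>auto simp: indicator_def split: if_splits\<close>)
qed

text \<open>The square of either side is |y|^2 |z|^2 - 2 r^2 (y . z) + r^4, which is symmetric in
  \<open>y\<close> and \<open>z\<close>. This identity carries the kernel through the change of
  variables.\<close>

lemma norm_diff_inversion:
  fixes y z :: "'a::real_inner"
  assumes "y \<noteq> 0" "z \<noteq> 0" "r \<noteq> 0"
  shows "norm z * norm (y - inversion r z) = norm y * norm (inversion r y - z)"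
proof -
  have "(norm z * norm (y - inversion r z))\<^sup>2 = (norm y * norm (inversion r y - z))\<^sup>2"
  proof -
    have sq: "(norm a * norm (b - inversion r a))\<^sup>2
        = (norm a)\<^sup>2 * (norm b)\<^sup>2 - 2 * r\<^sup>2 * (a \<bullet> b) + r ^ 4" if "a \<noteq> 0" for a b :: 'a
    proof -
      have "(norm (b - inversion r a))\<^sup>2 = (norm b)\<^sup>2 - 2 * (r / norm a)\<^sup>2 * (a \<bullet> b) + (r\<^sup>2 / norm a)\<^sup>2"
        unfolding norm_inversion[symmetric]
        by (simp add: power2_norm_eq_inner inner_diff_left inner_diff_right inner_commute)
           (simp add: inversion_def inner_commute)
      then show ?thesis
        using that by (simp add: power_mult_distrib power_divide field_simps)
    qed
    show ?thesis
      using sq[OF assms(2), of y] sq[OF assms(1), of z]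
      by (simp add: norm_minus_commute inner_commute mult.commute)
  qed
  then show ?thesis
    by (simp add: power2_eq_iff_nonneg)
qed

text \<open>The difference of the squares factors as (r^2 - |y|^2) (r^2 - |z|^2). This is why the
  kernel strictly dominates its reflection inside the ball.\<close>

lemma norm_inversion_diff_gt:
  fixes y z :: "'a::real_inner"
  assumes "y \<noteq> 0" "norm y < r" "norm z < r"
  shows "r * norm (y - z) < norm y * norm (inversion r y - z)"
proof (rule power2_less_imp_less)
  have "(norm y * norm (inversion r y - z))\<^sup>2
      = (norm y)\<^sup>2 * ((r\<^sup>2 / norm y)\<^sup>2 - 2 * (r / norm y)\<^sup>2 * (y \<bullet> z) + (norm z)\<^sup>2)"
    unfolding norm_inversion[symmetric] power_mult_distrib
    by (simp add: power2_norm_eq_inner inner_diff_left inner_diff_right inner_commute)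
       (simp add: inversion_def inner_commute)
  also have "\<dots> = r ^ 4 - 2 * r\<^sup>2 * (y \<bullet> z) + (norm y)\<^sup>2 * (norm z)\<^sup>2"
    using assms(1) by (simp add: power_divide field_simps)
  finally have "(norm y * norm (inversion r y - z))\<^sup>2 - (r * norm (y - z))\<^sup>2
      = (r\<^sup>2 - (norm y)\<^sup>2) * (r\<^sup>2 - (norm z)\<^sup>2)"
    by (simp add: power_mult_distrib power2_norm_eq_inner inner_diff_left inner_diff_right
        inner_commute algebra_simps)
  moreover have "0 < (r\<^sup>2 - (norm y)\<^sup>2) * (r\<^sup>2 - (norm z)\<^sup>2)"
    using assms by (intro mult_pos_pos) (auto intro!: power_strict_mono)
  ultimately show "(r * norm (y - z))\<^sup>2 < (norm y * norm (inversion r y - z))\<^sup>2"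
    by linarith
qed simp

lemma powr_diff_le_mult_diff:
  fixes a b M p :: real
  assumes "0 < b" "b \<le> a" "a \<le> M" "1 \<le> p"
  shows "a powr p - b powr p \<le> p * M powr (p - 1) * (a - b)"
proof (cases "b = a")
  case False
  then have "b < a" using assms by simp
  have "((\<lambda>x. x powr p) has_real_derivative p * x powr (p - 1)) (at x)" if "b \<le> x" for x
    using assms that by (intro has_real_derivative_powr) simp
  from MVT2[OF \<open>b < a\<close> this]
  obtain c where c: "b < c" "c < a" "a powr p - b powr p = (a - b) * (p * c powr (p - 1))"
    by blast
  have "c powr (p - 1) \<le> M powr (p - 1)"
    using c assms by (intro powr_mono2) auto
  then show ?thesis
    using c assms by (auto simp: mult_ac intro!: mult_left_mono)
qed auto

text \<open>Uniformity in \<open>y\<close> comes from translation: the integral of the kernel over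
  the ball of radius \<open>s\<close> about \<open>y\<close> is the same for all \<open>y\<close>,
  and below \<open>\<epsilon> / 2\<close> for small \<open>s\<close>. Outside this ball the kernel
  is at most \<open>s powr (- \<alpha>)\<close>, so a set of measure below
  \<open>\<epsilon> / 2 * s powr \<alpha>\<close> adds at most another
  \<open>\<epsilon> / 2\<close>.\<close>

lemma kernel_small:
  fixes \<alpha> \<rho> :: real
  assumes "0 < \<alpha>" "0 < \<rho>" "0 < \<epsilon>"
    and fin: "(\<integral>\<^sup>+z. ennreal (norm (z :: 'a::euclidean_space) powr (- \<alpha>)) * indicator (ball 0 \<rho>) z \<partial>lborel) < \<infinity>"
  shows "\<exists>\<delta>>0. \<forall>A\<in>sets borel. \<forall>y :: 'a. emeasure lborel A < ennreal \<delta> \<longrightarrow>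
       (\<integral>\<^sup>+z. ennreal (norm (y - z) powr (- \<alpha>)) * indicator A z \<partial>lborel) \<le> ennreal \<epsilon>"
proof -
  let ?k = "\<lambda>z :: 'a. ennreal (norm z powr (- \<alpha>))"
  have "(\<lambda>m. \<integral>\<^sup>+z. ?k z * indicator (ball 0 (\<rho> / real (Suc m))) z \<partial>lborel) \<longlonglongrightarrow> (\<integral>\<^sup>+(z :: 'a). 0 \<partial>lborel)"
  proof (rule nn_integral_dominated_convergence)
    show "AE z in lborel. (\<lambda>m. ?k z * indicator (ball 0 (\<rho> / real (Suc m))) z) \<longlonglongrightarrow> 0"
    proof (rule AE_mp[OF AE_lborel_norm_neq[of 0]], intro AE_I2 impI)
      fix z :: 'a assume "norm z \<noteq> 0"
      then have "0 < norm z" by simp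
      have "(\<lambda>m. \<rho> / real (Suc m)) \<longlonglongrightarrow> 0"
        by (intro LIMSEQ_Suc lim_const_over_n)
      then have "\<forall>\<^sub>F m in sequentially. \<rho> / real (Suc m) < norm z"
        by (rule order_tendstoD) fact
      then have "\<forall>\<^sub>F m in sequentially. ?k z * indicator (ball 0 (\<rho> / real (Suc m))) z = 0"
        by eventually_elim (simp add: indicator_def)
      then show "(\<lambda>m. ?k z * indicator (ball 0 (\<rho> / real (Suc m))) z) \<longlonglongrightarrow> 0"
        by (rule tendsto_eventually)
    qed
    show "AE z in lborel. ?k z * indicator (ball 0 (\<rho> / real (Suc m))) z \<le> ?k z * indicator (ball 0 \<rho>) z" for m
    proof (rule AE_I2)
      fix z :: 'a
      have "\<rho> / real (Suc m) \<le> \<rho>" using assms by (simp add: field_simps)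
      then show "?k z * indicator (ball 0 (\<rho> / real (Suc m))) z \<le> ?k z * indicator (ball 0 \<rho>) z"
        by (auto simp: indicator_def)
    qed
    show "(\<lambda>z. ?k z * indicator (ball 0 (\<rho> / real (Suc m))) z) \<in> borel_measurable lborel" for m
      by measurable
    show "(\<lambda>z. ?k z * indicator (ball 0 \<rho>) z) \<in> borel_measurable lborel"
      by measurable
  qed (use fin in simp_all)
  then have "(\<lambda>m. \<integral>\<^sup>+z. ?k z * indicator (ball 0 (\<rho> / real (Suc m))) z \<partial>lborel) \<longlonglongrightarrow> 0"
    by simp
  then have "\<forall>\<^sub>F m in sequentially. (\<integral>\<^sup>+z. ?k z * indicator (ball 0 (\<rho> / real (Suc m))) z \<partial>lborel) < ennreal (\<epsilon> / 2)"
    by (rule order_tendstoD) (use assms in simp)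
  then obtain m where m: "(\<integral>\<^sup>+z. ?k z * indicator (ball 0 (\<rho> / real (Suc m))) z \<partial>lborel) < ennreal (\<epsilon> / 2)"
    by (auto simp: eventually_sequentially)
  define s where "s = \<rho> / real (Suc m)"
  have s: "0 < s" using assms by (simp add: s_def)
  show ?thesis
  proof (intro exI[of _ "\<epsilon> / 2 * s powr \<alpha>"] conjI ballI allI impI)
    show "0 < \<epsilon> / 2 * s powr \<alpha>" using assms s by simp
    fix A :: "'a set" and y :: 'a
    assume [measurable]: "A \<in> sets borel" and A: "emeasure lborel A < ennreal (\<epsilon> / 2 * s powr \<alpha>)"
    have "(\<integral>\<^sup>+z. ?k (y - z) * indicator A z \<partial>lborel)
        \<le> (\<integral>\<^sup>+z. ?k (y - z) * indicator (ball 0 s) (y - z) + ennreal (s powr (- \<alpha>)) * indicator A z \<partial>lborel)"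
    proof (rule nn_integral_mono)
      fix z
      show "?k (y - z) * indicator A z \<le> ?k (y - z) * indicator (ball 0 s) (y - z) + ennreal (s powr (- \<alpha>)) * indicator A z"
      proof (cases "norm (y - z) < s")
        case False
        then have "norm (y - z) powr (- \<alpha>) \<le> s powr (- \<alpha>)"
          using s assms by (intro powr_mono2') auto
        with False show ?thesis by (auto simp: indicator_def)
      qed (auto simp: indicator_def)
    qed
    also have "\<dots> = (\<integral>\<^sup>+z. ?k z * indicator (ball 0 s) z \<partial>lborel) + ennreal (s powr (- \<alpha>)) * emeasure lborel A"
      by (subst nn_integral_add)
         (auto simp: nn_integral_lborel_diff[where F = "\<lambda>z. ?k z * indicator (ball 0 s) z"] nn_integral_cmult)
    also have "\<dots> \<le> ennreal (\<epsilon> / 2) + ennreal (s powr (- \<alpha>)) * ennreal (\<epsilon> / 2 * s powr \<alpha>)"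
      using m A by (intro add_mono mult_left_mono) (auto simp: s_def)
    also have "ennreal (s powr (- \<alpha>)) * ennreal (\<epsilon> / 2 * s powr \<alpha>) = ennreal (\<epsilon> / 2)"
      using s by (simp add: ennreal_mult'[symmetric] powr_minus field_simps)
    also have "ennreal (\<epsilon> / 2) + ennreal (\<epsilon> / 2) = ennreal \<epsilon>"
      using assms(3) by (simp add: ennreal_plus[symmetric] del: ennreal_plus)
    finally show "(\<integral>\<^sup>+z. ?k (y - z) * indicator A z \<partial>lborel) \<le> ennreal \<epsilon>" .
  qed
qed

section \<open>The integral equation and its Kelvin transform\<close>

text \<open>For \<open>\<alpha> = n - 2 * \<sigma>\<close>, \<open>p\<close> is the exponent (n + 2
  \<sigma>) / (n - 2 \<sigma>). \<open>Z\<close> is a closed null set rather than a subspace, so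
  that translates of a solution stay in the locale and every sphere can be centred at the origin.
  The nonnegative integral in \<open>solution\<close> is finite, being
  \<open>ennreal (u x)\<close>.\<close>

locale integral_equation =
  fixes \<alpha> p :: real and Z :: "'a::euclidean_space set" and u :: "'a \<Rightarrow> real"
  assumes alpha: "0 < \<alpha>" "\<alpha> < real DIM('a)"
    and p_def: "p = (2 * real DIM('a) - \<alpha>) / \<alpha>"
    and closed_Z: "closed Z" and null_Z: "Z \<in> null_sets lborel"
    and measurable_u [measurable]: "u \<in> borel_measurable borel"
    and u_nonneg: "\<And>x. 0 \<le> u x"
    and u_pos: "\<And>x. x \<notin> Z \<Longrightarrow> 0 < u x"
    and cont_u: "continuous_on (- Z) u"
    and solution: "\<And>x. x \<notin> Z \<Longrightarrow>
      (\<integral>\<^sup>+y. ennreal (u y powr p * norm (x - y) powr (- \<alpha>)) \<partial>lborel) = ennreal (u x)"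
begin

lemma p_gt_1: "1 < p"
  using alpha by (simp add: p_def field_simps)

lemma isCont_u: "x \<notin> Z \<Longrightarrow> isCont u x"
  using cont_u closed_Z by (simp add: continuous_on_eq_continuous_at open_Compl)

text \<open>Near a point off \<open>Z\<close> the solution is bounded below, so finiteness of the integral at that point
  bounds the integral of the bare kernel.\<close>

lemma kernel_locally_integrable:
  obtains \<rho> where "0 < \<rho>" and
    "(\<integral>\<^sup>+z. ennreal (norm (z :: 'a) powr (- \<alpha>)) * indicator (ball 0 \<rho>) z \<partial>lborel) < \<infinity>"
proof -
  have "Z \<noteq> UNIV"
    using null_Z by (auto simp: null_sets_def)
  then obtain x where x: "x \<notin> Z" by auto
  have "(u \<longlongrightarrow> u x) (at x)"
    using isCont_u[OF x] by (simp add: isCont_def)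
  then have "\<forall>\<^sub>F y in at x. u x / 2 < u y"
    by (rule order_tendstoD) (use u_pos[OF x] in simp)
  then obtain \<rho> where \<rho>: "0 < \<rho>" "\<And>y. y \<noteq> x \<Longrightarrow> dist y x < \<rho> \<Longrightarrow> u x / 2 < u y"
    by (auto simp: eventually_at)
  let ?k = "\<lambda>z :: 'a. ennreal (norm z powr (- \<alpha>))"
  let ?c = "(u x / 2) powr p"
  have c: "0 < ?c" using u_pos[OF x] by simp
  have "ennreal ?c * (\<integral>\<^sup>+z. ?k z * indicator (ball 0 \<rho>) z \<partial>lborel)
      = (\<integral>\<^sup>+z. ennreal ?c * (?k z * indicator (ball 0 \<rho>) z) \<partial>lborel)"
    by (rule nn_integral_cmult[symmetric]) measurable
  also have "\<dots> = (\<integral>\<^sup>+z. ennreal ?c * (?k (x - z) * indicator (ball 0 \<rho>) (x - z)) \<partial>lborel)"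
    by (rule nn_integral_lborel_diff[symmetric]) measurable
  also have "\<dots> \<le> (\<integral>\<^sup>+y. ennreal (u y powr p * norm (x - y) powr (- \<alpha>)) \<partial>lborel)"
  proof (rule nn_integral_mono)
    fix z
    show "ennreal ?c * (?k (x - z) * indicator (ball 0 \<rho>) (x - z)) \<le> ennreal (u z powr p * norm (x - z) powr (- \<alpha>))"
    proof (cases "z \<noteq> x \<and> dist z x < \<rho>")
      case True
      then have "?c \<le> u z powr p"
        using \<rho>(2)[of z] u_pos[OF x] p_gt_1 by (intro powr_mono2) auto
      then show ?thesis
        by (auto simp: indicator_def ennreal_mult''[symmetric] intro!: ennreal_leI mult_right_mono)
    next
      case False
      then show ?thesis by (auto simp: indicator_def dist_norm norm_minus_commute)
    qed
  qed
  also have "\<dots> < \<infinity>" using solution[OF x] by simp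
  finally have "(\<integral>\<^sup>+z. ?k z * indicator (ball 0 \<rho>) z \<partial>lborel) < \<infinity>"
    using c by (auto simp: ennreal_mult_less_top)
  with \<rho>(1) show thesis by (rule that)
qed

lemma kernel_small_on_small_sets:
  assumes "0 < \<epsilon>"
  shows "\<exists>\<delta>>0. \<forall>A\<in>sets borel. \<forall>y :: 'a. emeasure lborel A < ennreal \<delta> \<longrightarrow>
       (\<integral>\<^sup>+z. ennreal (norm (y - z) powr (- \<alpha>)) * indicator A z \<partial>lborel) \<le> ennreal \<epsilon>"
proof -
  obtain \<rho> where \<rho>: "0 < \<rho>"
    "(\<integral>\<^sup>+z. ennreal (norm (z :: 'a) powr (- \<alpha>)) * indicator (ball 0 \<rho>) z \<partial>lborel) < \<infinity>"
    by (rule kernel_locally_integrable)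
  show ?thesis
    by (rule kernel_small[OF alpha(1) \<rho>(1) assms \<rho>(2)])
qed

definition kelvin :: "real \<Rightarrow> 'a \<Rightarrow> real" where
  "kelvin r z = (r / norm z) powr \<alpha> * u (inversion r z)"

text \<open>For \<open>y \<noteq> 0\<close> this is \<open>(r / norm y) powr \<alpha> * norm (inversion r y - z) powr (- \<alpha>)\<close>.\<close>

definition reflected_kernel :: "real \<Rightarrow> 'a \<Rightarrow> 'a \<Rightarrow> real" where
  "reflected_kernel r y z = (norm y * norm (inversion r y - z) / r) powr (- \<alpha>)"

lemma measurable_kelvin [measurable]: "kelvin r \<in> borel_measurable borel"
  unfolding kelvin_def by measurable

lemma measurable_reflected_kernel [measurable]: "reflected_kernel r y \<in> borel_measurable borel"
  unfolding reflected_kernel_def by measurable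

lemma kelvin_nonneg: "0 \<le> kelvin r z"
  by (simp add: kelvin_def u_nonneg)

lemma kelvin_pos: "0 < r \<Longrightarrow> z \<noteq> 0 \<Longrightarrow> inversion r z \<notin> Z \<Longrightarrow> 0 < kelvin r z"
  by (simp add: kelvin_def u_pos)

lemma nn_integral_outside_ball:
  assumes r: "0 < r" and y: "y \<noteq> 0"
  shows "(\<integral>\<^sup>+z. ennreal (u z powr p * norm (y - z) powr (- \<alpha>)) * indicator (- ball 0 r) z \<partial>lborel)
     = (\<integral>\<^sup>+z. ennreal (kelvin r z powr p * reflected_kernel r y z) * indicator (ball 0 r) z \<partial>lborel)"
proof -
  let ?F = "\<lambda>z. ennreal (u z powr p * norm (y - z) powr (- \<alpha>)) * indicator (- ball 0 r) z"
  have "(\<integral>\<^sup>+z. ?F z \<partial>lborel)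
      = (\<integral>\<^sup>+z. ennreal ((r / norm z) ^ (2 * DIM('a))) * ?F (inversion r z) \<partial>lborel)"
    by (rule nn_integral_inversion[OF _ r]) measurable
  also have "\<dots> = (\<integral>\<^sup>+z. ennreal (kelvin r z powr p * reflected_kernel r y z) * indicator (ball 0 r) z \<partial>lborel)"
  proof (rule nn_integral_cong_AE)
    have pointwise: "ennreal ((r / norm z) ^ (2 * DIM('a))) * ?F (inversion r z)
        = ennreal (kelvin r z powr p * reflected_kernel r y z) * indicator (ball 0 r) z"
      if z: "norm z \<noteq> 0" "norm z \<noteq> r" for z
    proof (cases "norm z < r")
      case True
      then have "r \<le> r\<^sup>2 / norm z"
        using z r by (simp add: power2_eq_square pos_le_divide_eq)
      then have out: "indicator (- ball 0 r) (inversion r z) = (1 :: ennreal)"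
        by (simp add: indicator_def norm_inversion)
      let ?q = "r / norm z"
      have q: "0 < ?q" using z r by simp
      have e: "norm (y - inversion r z) = (norm y * norm (inversion r y - z) / r) * ?q"
        using norm_diff_inversion[of y z r] z y r by (simp add: field_simps)
      have 1: "norm (y - inversion r z) powr (- \<alpha>) = reflected_kernel r y z * ?q powr (- \<alpha>)"
        unfolding reflected_kernel_def e by (rule powr_mult)
      have "kelvin r z powr p = ?q powr (\<alpha> * p) * u (inversion r z) powr p"
        using q by (simp add: kelvin_def powr_mult u_nonneg powr_powr)
      \<comment> \<open>Conformal invariance: the Jacobian and the factor split off the kernel in
        \<open>1\<close> combine exactly into the weight of
        \<open>kelvin r z powr p\<close>.\<close>
      also have "\<alpha> * p = real (2 * DIM('a)) + (- \<alpha>)"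
        using alpha by (simp add: p_def)
      also have "?q powr (real (2 * DIM('a)) + (- \<alpha>)) = ?q ^ (2 * DIM('a)) * ?q powr (- \<alpha>)"
        using q by (simp only: powr_add powr_realpow)
      finally have 2: "kelvin r z powr p
          = ?q ^ (2 * DIM('a)) * ?q powr (- \<alpha>) * u (inversion r z) powr p" .
      have "?q ^ (2 * DIM('a)) * (u (inversion r z) powr p * norm (y - inversion r z) powr (- \<alpha>))
          = kelvin r z powr p * reflected_kernel r y z"
        unfolding 1 2 by (simp only: mult_ac)
      then show ?thesis
        using True out q by (simp add: ennreal_mult'[symmetric] indicator_def)
    next
      case False
      then have "r\<^sup>2 / norm z < r"
        using z r by (simp add: power2_eq_square pos_divide_less_eq)
      with False show ?thesis by (simp add: indicator_def norm_inversion)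
    qed
    show "AE z in lborel. ennreal ((r / norm z) ^ (2 * DIM('a))) * ?F (inversion r z)
        = ennreal (kelvin r z powr p * reflected_kernel r y z) * indicator (ball 0 r) z"
      using AE_lborel_norm_neq[of 0] AE_lborel_norm_neq[of r] by eventually_elim (rule pointwise)
  qed
  finally show ?thesis .
qed

lemma u_split_ball:
  assumes r: "0 < r" and y: "y \<noteq> 0" "y \<notin> Z"
  shows "ennreal (u y) =
     (\<integral>\<^sup>+z. ennreal (u z powr p * norm (y - z) powr (- \<alpha>)) * indicator (ball 0 r) z \<partial>lborel)
   + (\<integral>\<^sup>+z. ennreal (kelvin r z powr p * reflected_kernel r y z) * indicator (ball 0 r) z \<partial>lborel)"
proof -
  have "ennreal (u y) = (\<integral>\<^sup>+z. ennreal (u z powr p * norm (y - z) powr (- \<alpha>)) * indicator (ball 0 r) z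
      + ennreal (u z powr p * norm (y - z) powr (- \<alpha>)) * indicator (- ball 0 r) z \<partial>lborel)"
    unfolding solution[OF y(2), symmetric]
    by (intro nn_integral_cong) (auto simp: indicator_def)
  then show ?thesis
    using nn_integral_outside_ball[OF r y(1)] by (subst (asm) nn_integral_add) auto
qed

text \<open>This is \<open>u_split_ball\<close> at the point \<open>inversion r y\<close>,
  multiplied by \<open>(r / norm y) powr \<alpha>\<close>; this factor turns each of the two kernels
  into the other one at \<open>y\<close>.\<close>

lemma kelvin_split_ball:
  assumes r: "0 < r" and y: "y \<noteq> 0" "inversion r y \<notin> Z"
  shows "ennreal (kelvin r y) =
     (\<integral>\<^sup>+z. ennreal (u z powr p * reflected_kernel r y z) * indicator (ball 0 r) z \<partial>lborel)
   + (\<integral>\<^sup>+z. ennreal (kelvin r z powr p * norm (y - z) powr (- \<alpha>)) * indicator (ball 0 r) z \<partial>lborel)"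
proof -
  let ?q = "(r / norm y) powr \<alpha>"
  have q: "0 < ?q" "0 < r / norm y" using r y by auto
  have 1: "?q * norm (inversion r y - z) powr (- \<alpha>) = reflected_kernel r y z" for z
  proof -
    have "reflected_kernel r y z = (norm (inversion r y - z) * inverse (r / norm y)) powr (- \<alpha>)"
      by (simp add: reflected_kernel_def field_simps)
    also have "\<dots> = norm (inversion r y - z) powr (- \<alpha>) * inverse (r / norm y) powr (- \<alpha>)"
      by (rule powr_mult)
    also have "inverse (r / norm y) powr (- \<alpha>) = ?q"
      by (simp only: powr_minus inverse_powr inverse_inverse_eq)
    finally show ?thesis by simp
  qed
  have 2: "?q * reflected_kernel r (inversion r y) z = norm (y - z) powr (- \<alpha>)" for z
  proof -
    have "reflected_kernel r (inversion r y) z = (norm (y - z) * (r / norm y)) powr (- \<alpha>)"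
      using r by (simp add: reflected_kernel_def norm_inversion power2_eq_square mult.commute)
    also have "\<dots> = norm (y - z) powr (- \<alpha>) * (r / norm y) powr (- \<alpha>)"
      by (rule powr_mult)
    finally show ?thesis
      using q by (simp add: powr_minus)
  qed
  have "ennreal (kelvin r y) = ennreal ?q * ennreal (u (inversion r y))"
    by (simp add: kelvin_def ennreal_mult u_nonneg)
  also have "\<dots> = (\<integral>\<^sup>+z. ennreal ?q * (ennreal (u z powr p * norm (inversion r y - z) powr (- \<alpha>)) * indicator (ball 0 r) z) \<partial>lborel)
    + (\<integral>\<^sup>+z. ennreal ?q * (ennreal (kelvin r z powr p * reflected_kernel r (inversion r y) z) * indicator (ball 0 r) z) \<partial>lborel)"
    using r y by (subst u_split_ball[of r]) (simp_all add: distrib_left nn_integral_cmult)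
  also have "(\<lambda>z. ennreal ?q * (ennreal (u z powr p * norm (inversion r y - z) powr (- \<alpha>)) * indicator (ball 0 r) z))
      = (\<lambda>z. ennreal (u z powr p * reflected_kernel r y z) * indicator (ball 0 r) z)"
    by (simp only: 1[symmetric] mult.assoc[symmetric] ennreal_mult'[symmetric] powr_ge_zero) (simp only: mult_ac)
  also have "(\<lambda>z. ennreal ?q * (ennreal (kelvin r z powr p * reflected_kernel r (inversion r y) z) * indicator (ball 0 r) z))
      = (\<lambda>z. ennreal (kelvin r z powr p * norm (y - z) powr (- \<alpha>)) * indicator (ball 0 r) z)"
    by (simp only: 2[symmetric] mult.assoc[symmetric] ennreal_mult'[symmetric] powr_ge_zero) (simp only: mult_ac)
  finally show ?thesis .
qed

end

text \<open>The two expansions are to be subtracted, for which \<open>ennreal\<close> is unsuitable.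
  A finite sum has finite summands, so each piece can first become a Bochner integral.\<close>

lemma has_bochner_integral_of_nn_integral_add:
  fixes f g :: "'a \<Rightarrow> real"
  assumes [measurable]: "f \<in> borel_measurable M" "g \<in> borel_measurable M" "A \<in> sets M"
    and nonneg: "\<And>z. 0 \<le> f z" "\<And>z. 0 \<le> g z" and "0 \<le> c"
    and eq: "ennreal c = (\<integral>\<^sup>+z. ennreal (f z) * indicator A z \<partial>M) + (\<integral>\<^sup>+z. ennreal (g z) * indicator A z \<partial>M)"
  obtains a b where "has_bochner_integral M (\<lambda>z. indicator A z * f z) a"
    "has_bochner_integral M (\<lambda>z. indicator A z * g z) b" "c = a + b"
proof -
  let ?I = "\<lambda>h. \<integral>\<^sup>+z. ennreal (indicator A z * h z) \<partial>M"
  have I: "(\<integral>\<^sup>+z. ennreal (h z) * indicator A z \<partial>M) = ?I h" for h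
    by (intro nn_integral_cong) (simp add: indicator_def)
  have sum: "ennreal c = ?I f + ?I g" using eq unfolding I .
  have lt: "?I f \<noteq> top" "?I g \<noteq> top"
    using ennreal_neq_top[of c] unfolding sum by (auto simp del: ennreal_neq_top)
  define a where "a = enn2real (?I f)"
  define b where "b = enn2real (?I g)"
  have a: "?I f = ennreal a" "0 \<le> a" and b: "?I g = ennreal b" "0 \<le> b"
    unfolding a_def b_def using lt by (simp_all add: ennreal_enn2real_if)
  have "c = a + b"
    using sum a b \<open>0 \<le> c\<close> by (simp add: ennreal_plus[symmetric] del: ennreal_plus)
  moreover have "has_bochner_integral M (\<lambda>z. indicator A z * f z) a"
    by (rule has_bochner_integral_nn_integral[OF _ _ a(2,1)]) (auto simp: nonneg)
  moreover have "has_bochner_integral M (\<lambda>z. indicator A z * g z) b"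
    by (rule has_bochner_integral_nn_integral[OF _ _ b(2,1)]) (auto simp: nonneg)
  ultimately show thesis using that by blast
qed

context integral_equation
begin

lemma u_minus_kelvin_integral:
  assumes r: "0 < r" and y: "y \<noteq> 0" "y \<notin> Z" "inversion r y \<notin> Z"
  shows "has_bochner_integral lborel
    (\<lambda>z. indicator (ball 0 r) z *
       ((u z powr p - kelvin r z powr p) * (norm (y - z) powr (- \<alpha>) - reflected_kernel r y z)))
    (u y - kelvin r y)"
proof -
  obtain a b where
    a: "has_bochner_integral lborel (\<lambda>z. indicator (ball 0 r) z * (u z powr p * norm (y - z) powr (- \<alpha>))) a" and
    b: "has_bochner_integral lborel (\<lambda>z. indicator (ball 0 r) z * (kelvin r z powr p * reflected_kernel r y z)) b" and
    ab: "u y = a + b"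
    by (rule has_bochner_integral_of_nn_integral_add[OF _ _ _ _ _ _ u_split_ball[OF r y(1,2)]])
       (simp_all add: u_nonneg reflected_kernel_def)
  obtain c d where
    c: "has_bochner_integral lborel (\<lambda>z. indicator (ball 0 r) z * (u z powr p * reflected_kernel r y z)) c" and
    d: "has_bochner_integral lborel (\<lambda>z. indicator (ball 0 r) z * (kelvin r z powr p * norm (y - z) powr (- \<alpha>))) d" and
    cd: "kelvin r y = c + d"
    by (rule has_bochner_integral_of_nn_integral_add[OF _ _ _ _ _ _ kelvin_split_ball[OF r y(1,3)]])
       (simp_all add: kelvin_nonneg reflected_kernel_def)
  have "has_bochner_integral lborel
     (\<lambda>z. indicator (ball 0 r) z * (u z powr p * norm (y - z) powr (- \<alpha>))
        + indicator (ball 0 r) z * (kelvin r z powr p * reflected_kernel r y z)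
        - (indicator (ball 0 r) z * (u z powr p * reflected_kernel r y z)
        + indicator (ball 0 r) z * (kelvin r z powr p * norm (y - z) powr (- \<alpha>)))) (a + b - (c + d))"
    by (intro has_bochner_integral_diff has_bochner_integral_add a b c d)
  then show ?thesis
    unfolding ab cd by (simp only: algebra_simps)
qed

section \<open>Comparison of the solution with its Kelvin transform in one ball\<close>

lemma reflected_kernel_nonneg: "0 \<le> reflected_kernel r y z"
  by (simp add: reflected_kernel_def)

lemma reflected_kernel_less:
  assumes "0 < r" "y \<noteq> 0" "norm y < r" "norm z < r" "z \<noteq> y"
  shows "reflected_kernel r y z < norm (y - z) powr (- \<alpha>)"
proof -
  have "norm (y - z) < norm y * norm (inversion r y - z) / r"
    using norm_inversion_diff_gt[of y r z] assms by (simp add: field_simps)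
  then show ?thesis
    unfolding reflected_kernel_def using assms alpha by (intro powr_less_mono2_neg) auto
qed

text \<open>Two kinds of points are left out: at 0 the division convention makes
  \<open>kelvin r 0\<close> equal to 0, and where the image lies in \<open>Z\<close> the value of
  \<open>u\<close> carries no information.\<close>

definition below_kelvin :: "real \<Rightarrow> bool" where
  "below_kelvin r \<longleftrightarrow> (\<forall>z. z \<noteq> 0 \<longrightarrow> norm z < r \<longrightarrow> inversion r z \<notin> Z \<longrightarrow> u z \<le> kelvin r z)"

definition above_set :: "real \<Rightarrow> 'a set" where
  "above_set r = {z. norm z < r \<and> kelvin r z < u z}"

lemma above_set_measurable [measurable]: "above_set r \<in> sets borel"
  unfolding above_set_def by measurable

text \<open>The supremum of \<open>u - kelvin r\<close> is estimated by half of itself.\<close>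

lemma below_kelvin_if_small:
  assumes r: "0 < r" and ball: "ball 0 r \<inter> Z = {}" and M: "\<And>z. norm z < r \<Longrightarrow> u z \<le> M"
    and small: "\<And>y. (\<integral>\<^sup>+z. ennreal (norm (y - z) powr (- \<alpha>)) * indicator (above_set r) z \<partial>lborel) \<le> ennreal \<epsilon>"
    and \<epsilon>: "0 \<le> \<epsilon>" "p * M powr (p - 1) * \<epsilon> \<le> 1 / 2"
  shows "below_kelvin r"
proof (rule ccontr)
  let ?A = "above_set r"
  let ?C = "p * M powr (p - 1)"
  have notZ: "z \<notin> Z" if "norm z < r" for z
    using ball that by auto
  define D where "D = {u z - kelvin r z | z. z \<noteq> 0 \<and> z \<in> ?A \<and> inversion r z \<notin> Z}"
  define \<theta> where "\<theta> = Sup D"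
  assume "\<not> below_kelvin r"
  then obtain w where w: "w \<noteq> 0" "w \<in> ?A" "inversion r w \<notin> Z"
    by (auto simp: below_kelvin_def above_set_def not_le)
  then have wD: "u w - kelvin r w \<in> D" by (auto simp: D_def)
  \<comment> \<open>As \<open>kelvin r\<close> is nonnegative, the bound for \<open>u\<close> bounds
    \<open>D\<close> too. The supremum need not be attained, so the behaviour of
    \<open>kelvin r\<close> near 0 does not matter.\<close>
  have bdd: "bdd_above D"
  proof (rule bdd_aboveI[of _ M])
    fix t assume "t \<in> D"
    then obtain z where "t = u z - kelvin r z" "norm z < r"
      by (auto simp: D_def above_set_def)
    then show "t \<le> M" using M[of z] kelvin_nonneg[of r z] by linarith
  qed
  have "0 < u w - kelvin r w" using w by (simp add: above_set_def)
  also have "\<dots> \<le> \<theta>" unfolding \<theta>_def by (rule cSup_upper[OF wD bdd])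
  finally have \<theta>: "0 < \<theta>" .
  have C: "0 \<le> ?C" using p_gt_1 by simp
  have half: "u y - kelvin r y \<le> \<theta> / 2" if y: "y \<noteq> 0" "y \<in> ?A" "inversion r y \<notin> Z" for y
  proof -
    let ?F = "\<lambda>z. indicator (ball 0 r) z *
       ((u z powr p - kelvin r z powr p) * (norm (y - z) powr (- \<alpha>) - reflected_kernel r y z))"
    have yr: "norm y < r" using y by (simp add: above_set_def)
    have F: "has_bochner_integral lborel ?F (u y - kelvin r y)"
      by (rule u_minus_kelvin_integral[OF r y(1) notZ[OF yr] y(3)])
    let ?G = "\<lambda>z. indicator ?A z * norm (y - z) powr (- \<alpha>)"
    have nn: "(\<integral>\<^sup>+z. ennreal (?G z) \<partial>lborel) \<le> ennreal \<epsilon>"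
      using small[of y] by (simp add: ennreal_mult' ennreal_indicator mult.commute)
    have intG: "integrable lborel ?G"
      by (rule integrableI_nonneg) (use nn in \<open>auto simp: le_less_trans\<close>)
    have "integral\<^sup>L lborel ?G \<le> \<epsilon>"
      by (rule integral_real_bounded[OF \<epsilon>(1) nn])
    have "u y - kelvin r y = integral\<^sup>L lborel ?F"
      using F by (simp add: has_bochner_integral_integral_eq)
    \<comment> \<open>On \<open>?A\<close> the mean value theorem gives the factor
      \<open>?C * \<theta>\<close>, and dropping the reflected kernel only enlarges the integrand.
      Off \<open>?A\<close> the difference of powers is nonpositive while that of the kernels is
      positive.\<close>
    also have "\<dots> \<le> integral\<^sup>L lborel (\<lambda>z. (?C * \<theta>) * ?G z)"
    proof (rule integral_mono_AE)
      show "integrable lborel ?F" using F by (rule integrable.intros)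
      show "integrable lborel (\<lambda>z. (?C * \<theta>) * ?G z)" using intG by simp
      have "AE z in lborel. z \<noteq> y"
        using AE_lborel_singleton[of y] .
      moreover have "AE z in lborel. inversion r z \<notin> Z"
        by (rule AE_inversion_not_in_null_set[OF null_Z r])
      moreover have "AE z in lborel. norm (z :: 'a) \<noteq> 0"
        by (rule AE_lborel_norm_neq)
      ultimately show "AE z in lborel. ?F z \<le> (?C * \<theta>) * ?G z"
      proof eventually_elim
        case (elim z)
        show ?case
        proof (cases "norm z < r")
          case False
          then show ?thesis by (simp add: above_set_def)
        next
          case zr: True
          have k: "reflected_kernel r y z < norm (y - z) powr (- \<alpha>)"
            by (rule reflected_kernel_less[OF r y(1) yr zr elim(1)])
          show ?thesis
          proof (cases "z \<in> ?A")
            case True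
            have "u z - kelvin r z \<in> D"
              using True elim by (auto simp: D_def)
            then have "u z - kelvin r z \<le> \<theta>"
              unfolding \<theta>_def by (rule cSup_upper[OF _ bdd])
            have "u z powr p - kelvin r z powr p \<le> ?C * (u z - kelvin r z)"
              using True elim r p_gt_1 M[OF zr]
              by (intro powr_diff_le_mult_diff kelvin_pos) (auto simp: above_set_def)
            also have "\<dots> \<le> ?C * \<theta>"
              using C \<open>u z - kelvin r z \<le> \<theta>\<close> by (rule mult_left_mono[rotated])
            finally have "(u z powr p - kelvin r z powr p) * (norm (y - z) powr (- \<alpha>) - reflected_kernel r y z)
                \<le> (?C * \<theta>) * norm (y - z) powr (- \<alpha>)"
              using k C \<theta> reflected_kernel_nonneg[of r y z] by (intro mult_mono) auto
            then show ?thesis using True zr by simp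
          next
            case False
            then have "u z powr p \<le> kelvin r z powr p"
              using zr p_gt_1 u_nonneg by (intro powr_mono2) (auto simp: above_set_def)
            then show ?thesis
              using False zr k by (simp add: mult_nonpos_nonneg)
          qed
        qed
      qed
    qed
    also have "\<dots> = ?C * \<theta> * integral\<^sup>L lborel ?G"
      by (rule integral_mult_right_zero)
    also have "\<dots> \<le> ?C * \<theta> * \<epsilon>"
      using C \<theta> \<open>integral\<^sup>L lborel ?G \<le> \<epsilon>\<close> by (intro mult_left_mono) auto
    also have "\<dots> = (?C * \<epsilon>) * \<theta>" by (simp only: mult_ac)
    also have "\<dots> \<le> 1 / 2 * \<theta>" using \<epsilon>(2) \<theta> by (intro mult_right_mono) auto
    finally show ?thesis by simp
  qed
  have "\<theta> \<le> \<theta> / 2"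
    unfolding \<theta>_def by (rule cSup_least) (use wD half in \<open>auto simp: D_def \<theta>_def\<close>)
  with \<theta> show False by simp
qed

lemma continuous_on_inversion: "continuous_on (- {0}) (inversion r :: 'a \<Rightarrow> 'a)"
  unfolding inversion_def by (intro continuous_intros) auto

text \<open>Equality at one point makes the integral in \<open>u_minus_kelvin_integral\<close>
  vanish. Its integrand has a sign and the kernels differ strictly, so \<open>u\<close> and
  \<open>kelvin r\<close> agree almost everywhere in the ball. The point \<open>w\<close>
  contradicts this: at its image \<open>kelvin r\<close> exceeds \<open>u\<close>, and by continuity
  it does so on an open set.\<close>

lemma below_kelvin_strict:
  assumes r: "0 < r" and cball: "cball 0 r \<inter> Z = {}" and le: "below_kelvin r"
    and M: "\<And>z. norm z \<le> r \<Longrightarrow> u z \<le> M"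
    and w: "w \<notin> Z" "r < norm w" "M < u w"
    and y: "y \<noteq> 0" "norm y < r" "inversion r y \<notin> Z"
  shows "u y < kelvin r y"
proof (rule ccontr)
  assume "\<not> u y < kelvin r y"
  moreover have "u y \<le> kelvin r y" using le y by (simp add: below_kelvin_def)
  ultimately have eq: "u y - kelvin r y = 0" by simp
  let ?F = "\<lambda>z. indicator (ball 0 r) z *
     ((u z powr p - kelvin r z powr p) * (norm (y - z) powr (- \<alpha>) - reflected_kernel r y z))"
  have notZ: "z \<notin> Z" if "norm z \<le> r" for z
    using cball that by (metis IntI empty_iff mem_cball_0)
  have "y \<notin> Z" using y by (intro notZ) simp
  have F: "has_bochner_integral lborel ?F 0"
    using u_minus_kelvin_integral[OF r y(1) \<open>y \<notin> Z\<close> y(3)] unfolding eq .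
  have AEs: "AE z in lborel. z \<noteq> y" "AE z in lborel. inversion r z \<notin> Z" "AE z in lborel. norm (z :: 'a) \<noteq> 0"
    by (rule AE_lborel_singleton AE_inversion_not_in_null_set[OF null_Z r] AE_lborel_norm_neq)+
  have "AE z in lborel. 0 \<le> - ?F z"
    using AEs
  proof eventually_elim
    case (elim z)
    show ?case
    proof (cases "norm z < r")
      case True
      have "u z powr p \<le> kelvin r z powr p"
        using le elim True u_nonneg p_gt_1 by (intro powr_mono2) (auto simp: below_kelvin_def)
      moreover have "reflected_kernel r y z < norm (y - z) powr (- \<alpha>)"
        by (rule reflected_kernel_less[OF r y(1,2) True elim(1)])
      ultimately show ?thesis using True by (simp add: mult_nonpos_nonneg)
    qed simp
  qed
  moreover have "integrable lborel (\<lambda>z. - ?F z)"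
    using F by (auto intro: integrable.intros)
  moreover have "integral\<^sup>L lborel (\<lambda>z. - ?F z) = 0"
    using F by (simp add: has_bochner_integral_integral_eq)
  ultimately have "AE z in lborel. - ?F z = 0"
    using integral_nonneg_eq_0_iff_AE[of lborel "\<lambda>z. - ?F z"] by blast
  with AEs have AE_eq: "AE z in lborel. norm z < r \<longrightarrow> u z = kelvin r z"
  proof eventually_elim
    case (elim z)
    show ?case
    proof
      assume z: "norm z < r"
      have "reflected_kernel r y z < norm (y - z) powr (- \<alpha>)"
        by (rule reflected_kernel_less[OF r y(1,2) z elim(1)])
      then have "u z powr p = kelvin r z powr p"
        using elim(4) z by simp
      then have "(u z powr p) powr (1 / p) = (kelvin r z powr p) powr (1 / p)" by simp
      then show "u z = kelvin r z"
        using p_gt_1 by (simp add: powr_powr u_nonneg kelvin_nonneg)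
    qed
  qed
  define W where "W = {z \<in> ball 0 r - {0}. inversion r z \<in> - Z}"
  have "open W"
  proof -
    have "open ((ball 0 r - {0 :: 'a}) \<inter> inversion r -` (- Z))"
      using closed_Z by (intro continuous_open_preimage continuous_on_subset[OF continuous_on_inversion]) auto
    also have "(ball 0 r - {0}) \<inter> inversion r -` (- Z) = W" by (auto simp: W_def)
    finally show ?thesis .
  qed
  have "continuous_on W (\<lambda>z. kelvin r z - u z)"
    unfolding kelvin_def
  proof (intro continuous_intros continuous_on_compose2[OF cont_u])
    show "continuous_on W (inversion r)"
      by (rule continuous_on_subset[OF continuous_on_inversion]) (auto simp: W_def)
  qed (use r notZ in \<open>auto simp: W_def\<close>)
  then have "open (W \<inter> (\<lambda>z. kelvin r z - u z) -` {0<..})"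
    using \<open>open W\<close> by (intro continuous_open_preimage) auto
  \<comment> \<open>The factor \<open>(norm w / r) powr \<alpha>\<close> is at least 1, so
    \<open>kelvin r\<close> is at least \<open>u w\<close> there, which exceeds the bound
    \<open>M\<close> for \<open>u\<close>.\<close>
  moreover have "inversion r w \<in> W \<inter> (\<lambda>z. kelvin r z - u z) -` {0<..}"
  proof -
    have w0: "w \<noteq> 0" using w r by auto
    have n: "norm (inversion r w) < r"
      using w r w0 by (simp add: norm_inversion power2_eq_square pos_divide_less_eq)
    have "r / norm (inversion r w) = norm w / r"
      using r w0 by (simp add: norm_inversion power2_eq_square)
    then have "kelvin r (inversion r w) = (norm w / r) powr \<alpha> * u w"
      using r by (simp add: kelvin_def)
    moreover have "1 * u w \<le> (norm w / r) powr \<alpha> * u w"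
      using w r alpha u_nonneg by (intro mult_right_mono ge_one_powr_ge_zero) auto
    ultimately have "u (inversion r w) < kelvin r (inversion r w)"
      using M[of "inversion r w"] n w by simp
    then show ?thesis using n w w0 r by (simp add: W_def)
  qed
  ultimately have "\<not> negligible (W \<inter> (\<lambda>z. kelvin r z - u z) -` {0<..})"
    using open_not_negligible by blast
  moreover have "negligible (W \<inter> (\<lambda>z. kelvin r z - u z) -` {0<..})"
  proof -
    obtain N where N: "{z. \<not> (norm z < r \<longrightarrow> u z = kelvin r z)} \<subseteq> N" "N \<in> null_sets lborel"
      using AE_E[OF AE_eq] by (auto simp: null_sets_def)
    then have "negligible N"
      by (simp add: negligible_iff_null_sets null_sets_completionI)
    then show ?thesis
      by (rule negligible_subset) (use N(1) in \<open>auto simp: W_def\<close>)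
  qed
  ultimately show False by blast
qed

end

section \<open>Moving spheres\<close>

lemma tendsto_inversion:
  assumes "(X \<longlongrightarrow> r) F" "z \<noteq> 0"
  shows "((\<lambda>n. inversion (X n) z) \<longlongrightarrow> inversion r z) F"
  unfolding inversion_def by (intro tendsto_intros assms) (use assms in auto)

context integral_equation
begin

lemma tendsto_kelvin:
  assumes "(X \<longlongrightarrow> r) F" "z \<noteq> 0" "0 < r" "inversion r z \<notin> Z"
  shows "((\<lambda>n. kelvin (X n) z) \<longlongrightarrow> kelvin r z) F"
  unfolding kelvin_def
  by (intro tendsto_intros isCont_tendsto_compose[OF isCont_u] tendsto_inversion assms)
     (use assms in auto)

lemma eventually_inversion_not_in:
  assumes "(X \<longlongrightarrow> r) F" "z \<noteq> 0" "inversion r z \<notin> Z"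
  shows "\<forall>\<^sub>F n in F. inversion (X n) z \<notin> Z"
  using topological_tendstoD[OF tendsto_inversion[OF assms(1,2)], of "- Z"] closed_Z assms(3)
  by auto

text \<open>The indicators tend to 0 almost everywhere. A point inside the limit ball drops out
  because a strict inequality survives a small change of the radius, a point outside because the
  balls eventually miss it.\<close>

lemma emeasure_above_set_tendsto_0:
  assumes X: "X \<longlonglongrightarrow> r" and r: "0 < r"
    and strict: "\<And>z. z \<noteq> 0 \<Longrightarrow> norm z < r \<Longrightarrow> inversion r z \<notin> Z \<Longrightarrow> u z < kelvin r z"
    and cball: "cball 0 r \<inter> Z = {}"
  shows "(\<lambda>n. emeasure lborel (above_set (X n))) \<longlonglongrightarrow> 0"
proof -
  have notZ: "z \<notin> Z" if "norm z \<le> r" for z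
    using cball that by (metis IntI empty_iff mem_cball_0)
  obtain R where R: "\<And>n. \<bar>X n\<bar> \<le> R"
    using convergent_imp_Bseq[of X] X by (auto simp: convergent_def Bseq_def)
  have "(\<lambda>n. \<integral>\<^sup>+z. indicator (above_set (X n)) z \<partial>lborel) \<longlonglongrightarrow> (\<integral>\<^sup>+(z :: 'a). 0 \<partial>lborel)"
  proof (rule nn_integral_dominated_convergence)
    show "AE z in lborel. indicator (above_set (X n)) z \<le> (indicator (ball 0 R) z :: ennreal)" for n
      using R[of n] by (intro AE_I2) (auto simp: indicator_def above_set_def)
    show "(\<integral>\<^sup>+z. indicator (ball (0 :: 'a) R) z \<partial>lborel) < \<infinity>"
      using emeasure_bounded_finite[OF bounded_ball[of "0 :: 'a" R]] by simp
    have "AE z in lborel. norm (z :: 'a) \<noteq> 0" "AE z in lborel. norm (z :: 'a) \<noteq> r"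
      "AE z in lborel. inversion r z \<notin> Z"
      by (rule AE_lborel_norm_neq AE_inversion_not_in_null_set[OF null_Z r])+
    then show "AE z in lborel. (\<lambda>n. indicator (above_set (X n)) z :: ennreal) \<longlonglongrightarrow> 0"
    proof eventually_elim
      case (elim z)
      have "\<forall>\<^sub>F n in sequentially. z \<notin> above_set (X n)"
      proof (cases "norm z < r")
        case True
        have "u z < kelvin r z" using strict elim True by auto
        from order_tendstoD(1)[OF tendsto_kelvin[OF X _ r elim(3)] this] elim(1)
        show ?thesis by (auto simp: above_set_def elim!: eventually_mono)
      next
        case False
        then have "r < norm z" using elim by simp
        from order_tendstoD(2)[OF X this] show ?thesis
          by (auto simp: above_set_def elim!: eventually_mono)
      qed
      then show ?case
        by (intro tendsto_eventually) (auto simp: indicator_def elim!: eventually_mono)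
    qed
  qed auto
  then show ?thesis by simp
qed

lemma u_bounded_on_cball:
  assumes "cball 0 r \<inter> Z = {}"
  obtains M where "0 < M" "\<And>z. norm z \<le> r \<Longrightarrow> u z \<le> M"
proof -
  have "bounded (u ` cball 0 r)"
    by (intro compact_imp_bounded compact_continuous_image continuous_on_subset[OF cont_u])
       (use assms in auto)
  then obtain M where "0 < M" "\<forall>t \<in> u ` cball 0 r. norm t \<le> M"
    unfolding bounded_pos by blast
  then have "u z \<le> M" if "norm z \<le> r" for z
  proof -
    have "u z \<in> u ` cball 0 r" using that by simp
    with \<open>\<forall>t\<in>u ` cball 0 r. norm t \<le> M\<close> have "norm (u z) \<le> M" by blast
    then show ?thesis by simp
  qed
  with \<open>0 < M\<close> show thesis by (rule that)
qed

text \<open>One \<open>\<delta>\<close> serves all radii up to \<open>r\<close>, because a bound for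
  \<open>u\<close> on the largest ball holds on the smaller ones. It is used both to start from
  small radii and to pass beyond an admissible one.\<close>

lemma small_above_set_imp_below_kelvin:
  assumes cball: "cball 0 r \<inter> Z = {}"
  obtains \<delta> where "0 < \<delta>"
    "\<And>s. 0 < s \<Longrightarrow> s \<le> r \<Longrightarrow> emeasure lborel (above_set s) < ennreal \<delta> \<Longrightarrow> below_kelvin s"
proof -
  obtain M where M: "0 < M" "\<And>z. norm z \<le> r \<Longrightarrow> u z \<le> M"
    using u_bounded_on_cball[OF cball] by blast
  \<comment> \<open>Chosen to make \<open>p * M powr (p - 1) * \<epsilon>\<close> equal to 1/2, the
    factor allowed by \<open>below_kelvin_if_small\<close>.\<close>
  define \<epsilon> where "\<epsilon> = 1 / (2 * (p * M powr (p - 1)))"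
  have C: "0 < p * M powr (p - 1)" using M p_gt_1 by simp
  then have \<epsilon>: "0 < \<epsilon>" "p * M powr (p - 1) * \<epsilon> \<le> 1 / 2" by (simp_all add: \<epsilon>_def)
  from kernel_small_on_small_sets[OF this(1)] obtain \<delta> where \<delta>: "0 < \<delta>"
    "\<And>A (y :: 'a). A \<in> sets borel \<Longrightarrow> emeasure lborel A < ennreal \<delta> \<Longrightarrow>
       (\<integral>\<^sup>+z. ennreal (norm (y - z) powr (- \<alpha>)) * indicator A z \<partial>lborel) \<le> ennreal \<epsilon>"
    by blast
  show thesis
  proof (rule that[OF \<delta>(1)])
    fix s assume s: "0 < s" "s \<le> r" "emeasure lborel (above_set s) < ennreal \<delta>"
    show "below_kelvin s"
    proof (rule below_kelvin_if_small[OF s(1)])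
      have "ball 0 s \<subseteq> cball (0 :: 'a) r" using s by auto
      then show "ball 0 s \<inter> Z = {}" using cball by blast
      show "\<And>z. norm z < s \<Longrightarrow> u z \<le> M" using M(2) s by simp
      show "(\<integral>\<^sup>+z. ennreal (norm (y - z) powr (- \<alpha>)) * indicator (above_set s) z \<partial>lborel) \<le> ennreal \<epsilon>" for y
        by (rule \<delta>(2)[OF above_set_measurable s(3)])
    qed (use \<epsilon> in auto)
  qed
qed

text \<open>Because \<open>Z\<close> is closed, an image off \<open>Z\<close> stays off
  \<open>Z\<close> for nearby radii, so the inequalities at the same point \<open>z\<close> are
  available and pass to the limit.\<close>

lemma below_kelvin_limit:
  assumes X: "X \<longlonglongrightarrow> r" and r: "0 < r" and below: "\<forall>\<^sub>F n in sequentially. below_kelvin (X n)"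
  shows "below_kelvin r"
  unfolding below_kelvin_def
proof (intro allI impI)
  fix z :: 'a assume z: "z \<noteq> 0" "norm z < r" "inversion r z \<notin> Z"
  have "\<forall>\<^sub>F n in sequentially. u z \<le> kelvin (X n) z"
    using below order_tendstoD(1)[OF X z(2)] eventually_inversion_not_in[OF X z(1,3)]
    by eventually_elim (use z in \<open>auto simp: below_kelvin_def\<close>)
  then show "u z \<le> kelvin r z"
    by (intro tendsto_lowerbound[OF tendsto_kelvin[OF X z(1) r z(3)]]) auto
qed

theorem moving_spheres:
  assumes ball: "ball 0 d \<inter> Z = {}"
    and unbounded: "\<And>r M. r < d \<Longrightarrow> \<exists>w. w \<notin> Z \<and> r < norm w \<and> M < u w"
    and r: "0 < r" "r < d"
  shows "below_kelvin r"
proof -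
  have cball: "cball 0 s \<inter> Z = {}" if "s < d" for s
  proof -
    have "cball 0 s \<subseteq> ball (0 :: 'a) d" using that by auto
    then show ?thesis using ball by blast
  qed
  define U where "U = {s \<in> {0<..<d}. below_kelvin s}"
  define V where "V = {0<..<d} - U"
  have near: "\<forall>\<^sub>F n in sequentially. X n \<in> U" if X: "X \<longlonglongrightarrow> s" and s: "s \<in> U" for X s
  proof -
    have sd: "0 < s" "s < d" "below_kelvin s" using s by (auto simp: U_def)
    \<comment> \<open>Radii slightly above \<open>s\<close> must be covered by the bound for
      \<open>u\<close>, and the larger ball must still miss \<open>Z\<close>.\<close>
    define t where "t = (s + d) / 2"
    have t: "s < t" "t < d" using sd by (auto simp: t_def)
    obtain \<delta> where \<delta>: "0 < \<delta>"
      "\<And>s. 0 < s \<Longrightarrow> s \<le> t \<Longrightarrow> emeasure lborel (above_set s) < ennreal \<delta> \<Longrightarrow> below_kelvin s"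
      using small_above_set_imp_below_kelvin[OF cball[OF t(2)]] by blast
    obtain M where M: "\<And>z. norm z \<le> s \<Longrightarrow> u z \<le> M"
      using u_bounded_on_cball[OF cball[OF sd(2)]] by blast
    obtain w where w: "w \<notin> Z" "s < norm w" "M < u w" using unbounded[OF sd(2)] by blast
    have "(\<lambda>n. emeasure lborel (above_set (X n))) \<longlonglongrightarrow> 0"
      by (rule emeasure_above_set_tendsto_0[OF X sd(1) _ cball[OF sd(2)]])
         (rule below_kelvin_strict[OF sd(1) cball[OF sd(2)] sd(3) M w])
    then have "\<forall>\<^sub>F n in sequentially. emeasure lborel (above_set (X n)) < ennreal \<delta>"
      by (rule order_tendstoD) (use \<delta> in simp)
    with order_tendstoD(1)[OF X sd(1)] order_tendstoD(2)[OF X t(1)] show ?thesis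
      by eventually_elim (use \<delta>(2) t in \<open>auto simp: U_def\<close>)
  qed
  have "open U"
  proof -
    have "closed (- U)"
      unfolding closed_sequential_limits
    proof (intro allI impI)
      fix X s assume X: "(\<forall>n. X n \<in> - U) \<and> X \<longlonglongrightarrow> s"
      show "s \<in> - U"
      proof
        assume "s \<in> U"
        from near[OF _ this] X have "\<forall>\<^sub>F n in sequentially. X n \<in> U" by blast
        with X have "\<forall>\<^sub>F n :: nat in sequentially. False" by (auto elim: eventually_mono)
        then show False by simp
      qed
    qed
    then show ?thesis by (simp add: open_closed)
  qed
  have "open V"
  proof -
    have "closed (- V)"
      unfolding closed_sequential_limits
    proof (intro allI impI)
      fix X s assume X: "(\<forall>n. X n \<in> - V) \<and> X \<longlonglongrightarrow> s"
      show "s \<in> - V"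
      proof
        assume s: "s \<in> V"
        then have s': "0 < s" "s < d" by (auto simp: V_def)
        from X order_tendstoD(1)[of X s sequentially, OF _ s'(1)] order_tendstoD(2)[of X s sequentially, OF _ s'(2)]
        have "\<forall>\<^sub>F n in sequentially. 0 < X n" "\<forall>\<^sub>F n in sequentially. X n < d" by auto
        then have "\<forall>\<^sub>F n in sequentially. below_kelvin (X n)"
          by eventually_elim (use X in \<open>auto simp: V_def U_def\<close>)
        with below_kelvin_limit[OF _ s'(1)] X have "below_kelvin s" by blast
        with s s' show False by (auto simp: V_def U_def)
      qed
    qed
    then show ?thesis by (simp add: open_closed)
  qed
  \<comment> \<open>Small radii are admissible: \<open>above_set s\<close> lies in a ball whose
    volume tends to 0 with \<open>s\<close>.\<close>
  have "U \<inter> {0<..<d} \<noteq> {}"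
  proof -
    have "(\<lambda>n. r / real (Suc n)) \<longlonglongrightarrow> 0"
      by (intro LIMSEQ_Suc lim_const_over_n)
    moreover have "(\<lambda>n. emeasure lborel (above_set (r / real (Suc n)))) \<longlonglongrightarrow> 0"
    proof (rule tendsto_sandwich[of "\<lambda>_. 0"])
      have "(\<lambda>n. unit_ball_vol (real DIM('a)) * (r / real (Suc n)) ^ DIM('a)) \<longlonglongrightarrow> unit_ball_vol (real DIM('a)) * 0 ^ DIM('a)"
        by (intro tendsto_intros LIMSEQ_Suc lim_const_over_n)
      then have "(\<lambda>n. ennreal (unit_ball_vol (real DIM('a)) * (r / real (Suc n)) ^ DIM('a))) \<longlonglongrightarrow> ennreal 0"
        by (intro tendsto_ennrealI) (simp add: zero_power)
      then show "(\<lambda>n. ennreal (unit_ball_vol (real DIM('a)) * (r / real (Suc n)) ^ DIM('a))) \<longlonglongrightarrow> 0"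
        by simp
      have "emeasure lborel (above_set s) \<le> ennreal (unit_ball_vol (real DIM('a)) * s ^ DIM('a))"
        if "0 \<le> s" for s
      proof -
        have "emeasure lborel (above_set s) \<le> emeasure lborel (ball (0 :: 'a) s)"
          by (intro emeasure_mono) (auto simp: above_set_def)
        also have "\<dots> = ennreal (unit_ball_vol (real DIM('a)) * s ^ DIM('a))"
          by (rule emeasure_ball[OF that])
        finally show ?thesis .
      qed
      then show "\<forall>\<^sub>F n in sequentially. emeasure lborel (above_set (r / real (Suc n)))
          \<le> ennreal (unit_ball_vol (real DIM('a)) * (r / real (Suc n)) ^ DIM('a))"
        using r by (intro always_eventually allI) simp
    qed auto
    moreover obtain \<delta> where \<delta>: "0 < \<delta>"
      "\<And>s. 0 < s \<Longrightarrow> s \<le> r \<Longrightarrow> emeasure lborel (above_set s) < ennreal \<delta> \<Longrightarrow> below_kelvin s"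
      using small_above_set_imp_below_kelvin[OF cball[OF r(2)]] by blast
    ultimately have "\<forall>\<^sub>F n in sequentially. emeasure lborel (above_set (r / real (Suc n))) < ennreal \<delta>"
      by (intro order_tendstoD(2)) auto
    then obtain n where n: "emeasure lborel (above_set (r / real (Suc n))) < ennreal \<delta>"
      by (auto simp: eventually_sequentially)
    have s: "0 < r / real (Suc n)" "r / real (Suc n) \<le> r"
      using r by (simp_all add: field_simps)
    have "r / real (Suc n) \<in> U"
      using \<delta>(2)[OF s n] s r by (simp add: U_def)
    then show ?thesis by (auto simp: U_def)
  qed
  moreover have "connected {0<..<d}" by simp
  ultimately have "V \<inter> {0<..<d} = {}"
    using connectedD[of "{0<..<d}" U V] \<open>open U\<close> \<open>open V\<close> by (auto simp: V_def)
  then show ?thesis using r by (auto simp: V_def U_def)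
qed

end

section \<open>Limit to hyperplanes and symmetry\<close>

lemma add_orthogonal_comp_notin_subspace:
  assumes "subspace S" "x \<in> S" "y \<in> orthogonal_comp S" "y \<noteq> 0"
  shows "x + y \<notin> S"
proof
  assume "x + y \<in> S"
  then have "(x + y) - x \<in> S" using assms(1,2) by (intro subspace_diff)
  then have "y \<bullet> y = 0" using assms(3) by (simp add: orthogonal_comp_def orthogonal_def)
  then show False using assms(4) by simp
qed

context integral_equation
begin

text \<open>All results so far are about spheres centred at the origin; this makes them available
  for any centre \<open>c\<close>.\<close>

lemma translate: "integral_equation \<alpha> p ((+) c -` Z) (\<lambda>z. u (c + z))"
proof
  show closed: "closed ((+) c -` Z)"
    by (intro closed_vimage closed_Z continuous_intros)
  show "(+) c -` Z \<in> null_sets lborel"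
  proof -
    have [measurable]: "Z \<in> sets borel" using closed_Z by (rule borel_closed)
    have "emeasure lborel ((+) c -` Z) = emeasure (distr lborel borel ((+) c)) Z"
      by (simp add: emeasure_distr)
    also have "\<dots> = 0"
      unfolding lborel_distr_plus using null_Z by auto
    finally show ?thesis
      using borel_closed[OF closed] by (simp add: null_sets_def)
  qed
  show "continuous_on (- ((+) c -` Z)) (\<lambda>z. u (c + z))"
    by (intro continuous_on_compose2[OF cont_u] continuous_intros) auto
  fix x assume "x \<notin> (+) c -` Z"
  then have "c + x \<notin> Z" by simp
  from solution[OF this] show "(\<integral>\<^sup>+y. ennreal (u (c + y) powr p * norm (x - y) powr (- \<alpha>)) \<partial>lborel) = ennreal (u (c + x))"
    using nn_integral_lborel_translate[of "\<lambda>y. ennreal (u y powr p * norm (c + x - y) powr (- \<alpha>))" c]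
    by simp
qed (use alpha p_def u_nonneg u_pos in auto)

definition singular_at :: "'a \<Rightarrow> bool" where
  "singular_at x0 \<longleftrightarrow> (\<forall>M. \<forall>\<epsilon>>0. \<exists>w. w \<notin> Z \<and> dist w x0 < \<epsilon> \<and> M < u w)"

text \<open>The unit vector \<open>e\<close> is orthogonal to \<open>Z\<close>, so the centre
  \<open>R e\<close> has distance \<open>R\<close> from \<open>Z\<close>, and points near
  \<open>x0\<close> provide large values of \<open>u\<close> outside every ball of smaller radius.
  The ball of radius \<open>R - a\<close> touches the hyperplane x . e = a from the side away from
  \<open>y\<close>; hence \<open>y\<close> is outside, and the claim is the comparison at its
  image.\<close>

lemma sphere_comparison:
  assumes "subspace Z" and e: "norm e = 1" "e \<in> orthogonal_comp Z"
    and x0: "x0 \<in> Z" "singular_at x0"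
    and a: "0 < a" and y: "y \<notin> Z" "y \<bullet> e < a" and R: "a < R"
  shows "u (R *\<^sub>R e + inversion (R - a) (y - R *\<^sub>R e)) \<le> (norm (y - R *\<^sub>R e) / (R - a)) powr \<alpha> * u y"
proof -
  let ?c = "R *\<^sub>R e" and ?Z = "(+) (R *\<^sub>R e) -` Z"
  interpret T: integral_equation \<alpha> p ?Z "\<lambda>z. u (?c + z)" by (rule translate)
  have ee: "e \<bullet> e = 1" using e(1) by (simp add: norm_eq_1)
  have inner_le: "\<bar>z \<bullet> e\<bar> \<le> norm z" for z
    using Cauchy_Schwarz_ineq2[of z e] e(1) by simp
  have far: "R \<le> norm (z - ?c)" if "z \<in> Z" for z
  proof -
    have "z \<bullet> e = 0" using e(2) that by (simp add: orthogonal_comp_def orthogonal_def)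
    then show ?thesis
      using inner_le[of "z - ?c"] ee by (simp add: inner_diff_left)
  qed
  have "T.below_kelvin (R - a)"
  proof (rule T.moving_spheres)
    show "ball 0 R \<inter> ?Z = {}"
      using far[of "?c + z" for z] by fastforce
    fix r M assume "r < R"
    then obtain w where w: "w \<notin> Z" "dist w x0 < R - r" "M < u w"
      using x0(2) unfolding singular_at_def by (metis diff_gt_0_iff_gt)
    have "norm (x0 - ?c) \<le> norm (w - ?c) + dist w x0"
      using norm_triangle_ineq[of "w - ?c" "x0 - w"] by (simp add: dist_norm norm_minus_commute)
    then have "r < norm (w - ?c)" using far[OF x0(1)] w(2) by linarith
    then show "\<exists>w. w \<notin> ?Z \<and> r < norm w \<and> M < u (?c + w)"
      using w by (intro exI[of _ "w - ?c"]) simp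
  qed (use a R in auto)
  moreover
  let ?y = "y - ?c"
  let ?z = "inversion (R - a) ?y"
  have q: "0 < R - a" using R by simp
  have "R - y \<bullet> e \<le> norm ?y"
    using inner_le[of ?y] ee by (simp add: inner_diff_left)
  then have yq: "R - a < norm ?y" using y(2) by linarith
  then have y0: "?y \<noteq> 0" using q by auto
  have nz: "norm ?z = (R - a)\<^sup>2 / norm ?y" by (rule norm_inversion)
  have "norm ?z < R - a"
    unfolding nz pos_divide_less_eq[OF less_trans[OF q yq]] power2_eq_square
    using yq q by (intro mult_strict_left_mono)
  moreover have "?z \<noteq> 0" using y0 q by simp
  moreover have "inversion (R - a) ?z \<notin> ?Z" using y(1) q by simp
  ultimately have "u (?c + ?z) \<le> T.kelvin (R - a) ?z"
    unfolding T.below_kelvin_def by blast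
  also have "(R - a) / norm ?z = norm ?y / (R - a)"
    unfolding nz using y0 q by (simp add: power2_eq_square)
  then have "T.kelvin (R - a) ?z = (norm ?y / (R - a)) powr \<alpha> * u y"
    unfolding T.kelvin_def using q by simp
  finally show ?thesis .
qed

text \<open>Spheres of centre \<open>R e\<close> and radius \<open>R - a\<close> converge to the hyperplane \<open>x \<bullet> e = a\<close> as \<open>R\<close>
  tends to infinity.\<close>

lemma plane_comparison:
  assumes "subspace Z" and e: "norm e = 1" "e \<in> orthogonal_comp Z"
    and x0: "x0 \<in> Z" "singular_at x0"
    and a: "0 < a" and y: "y \<notin> Z" "y \<bullet> e < a"
  shows "u (y + (2 * (a - y \<bullet> e)) *\<^sub>R e) \<le> u y"
proof -
  let ?t = "y \<bullet> e" and ?s = "(norm y)\<^sup>2"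
  let ?n = "\<lambda>R. norm (y - R *\<^sub>R e)"
  \<comment> \<open>With this \<open>?f\<close> the image of \<open>y\<close> is
    \<open>y + ?f R *\<^sub>R y - (R * ?f R) *\<^sub>R e\<close>. As \<open>?f R\<close> decays like
    1/R, only the limit of \<open>R * ?f R\<close> survives, and it produces the reflection.\<close>
  let ?f = "\<lambda>R. ((R - a) / ?n R)\<^sup>2 - 1"
  have ee: "e \<bullet> e = 1" using e(1) by (simp add: norm_eq_1)
  have n2: "(?n R)\<^sup>2 = R\<^sup>2 - 2 * R * ?t + ?s" for R
    unfolding power2_norm_eq_inner
    by (simp add: inner_diff_left inner_diff_right ee inner_commute power2_eq_square algebra_simps)
  have n: "?n R = sqrt (R\<^sup>2 - 2 * R * ?t + ?s)" for R
    unfolding n2[symmetric] by simp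
  have f: "?f R = (R - a)\<^sup>2 / (R\<^sup>2 - 2 * R * ?t + ?s) - 1" for R
    by (simp only: power_divide n2)
  have "(?f \<longlongrightarrow> 0) at_top"
    unfolding f by real_asymp
  moreover have "((\<lambda>R. R * ?f R) \<longlongrightarrow> 2 * ?t - 2 * a) at_top"
    unfolding f by real_asymp
  ultimately have "((\<lambda>R. y + ?f R *\<^sub>R y - (R * ?f R) *\<^sub>R e) \<longlongrightarrow> y + 0 *\<^sub>R y - (2 * ?t - 2 * a) *\<^sub>R e) at_top"
    by (intro tendsto_intros)
  moreover have "(\<lambda>R. y + ?f R *\<^sub>R y - (R * ?f R) *\<^sub>R e) = (\<lambda>R. R *\<^sub>R e + inversion (R - a) (y - R *\<^sub>R e))"
    by (simp add: fun_eq_iff inversion_def algebra_simps)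
  moreover have "y + 0 *\<^sub>R y - (2 * ?t - 2 * a) *\<^sub>R e = y + (2 * (a - ?t)) *\<^sub>R e"
    by (simp add: algebra_simps)
  ultimately have lim: "((\<lambda>R. R *\<^sub>R e + inversion (R - a) (y - R *\<^sub>R e)) \<longlongrightarrow> y + (2 * (a - ?t)) *\<^sub>R e) at_top"
    by (simp only:)
  \<comment> \<open>Its inner product with \<open>e\<close> is \<open>2 * a - ?t\<close>, which
    exceeds \<open>a\<close>, whereas \<open>e\<close> is orthogonal to \<open>Z\<close>.\<close>
  have "y + (2 * (a - ?t)) *\<^sub>R e \<notin> Z"
  proof
    assume "y + (2 * (a - ?t)) *\<^sub>R e \<in> Z"
    then have "(y + (2 * (a - ?t)) *\<^sub>R e) \<bullet> e = 0"
      using e(2) by (simp add: orthogonal_comp_def orthogonal_def)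
    then show False using ee a y(2) by (simp add: inner_add_left)
  qed
  from isCont_tendsto_compose[OF isCont_u[OF this] lim]
  have "((\<lambda>R. u (R *\<^sub>R e + inversion (R - a) (y - R *\<^sub>R e))) \<longlongrightarrow> u (y + (2 * (a - ?t)) *\<^sub>R e)) at_top" .
  moreover have "((\<lambda>R. (?n R / (R - a)) powr \<alpha> * u y) \<longlongrightarrow> 1 powr \<alpha> * u y) at_top"
  proof -
    have "((\<lambda>R. ?n R / (R - a)) \<longlongrightarrow> 1) at_top"
      unfolding n by real_asymp
    then show ?thesis by (intro tendsto_intros) auto
  qed
  moreover have "\<forall>\<^sub>F R in at_top. u (R *\<^sub>R e + inversion (R - a) (y - R *\<^sub>R e)) \<le> (?n R / (R - a)) powr \<alpha> * u y"
    using eventually_gt_at_top[of a]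
    by eventually_elim (rule sphere_comparison[OF assms])
  ultimately show ?thesis
    using tendsto_le[OF trivial_limit_at_top_linorder] by fastforce
qed

text \<open>Because the norms agree, the reflection in the hyperplane through 0 orthogonal to
  \<open>x - y\<close> swaps \<open>x\<close> and \<open>y\<close>, and it fixes \<open>x'\<close>.
  \<open>plane_comparison\<close> asks for a positive offset \<open>a\<close>, which yields the
  point \<open>x' + x + (2 * a) *\<^sub>R e\<close>; continuity off \<open>Z\<close> allows
  \<open>a\<close> to tend to 0.\<close>

lemma symmetric_le:
  assumes Z: "subspace Z" and x0: "x0 \<in> Z" "singular_at x0"
    and x': "x' \<in> Z" and x: "x \<in> orthogonal_comp Z" "y \<in> orthogonal_comp Z"
    and nz: "x \<noteq> 0" and eq: "norm x = norm y"
  shows "u (x' + x) \<le> u (x' + y)"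
proof (cases "x = y")
  case False
  note notin = add_orthogonal_comp_notin_subspace[OF Z x']
  define N where "N = norm (x - y)"
  define e where "e = (1 / N) *\<^sub>R (x - y)"
  have N: "0 < N" using False by (simp add: N_def)
  have e: "norm e = 1" using N by (simp add: e_def N_def)
  have eZ: "e \<in> orthogonal_comp Z"
    unfolding e_def using x subspace_orthogonal_comp[of Z]
    by (intro subspace_scale subspace_diff) auto
  have xx: "x \<bullet> x = y \<bullet> y"
    using eq by (simp add: norm_eq_sqrt_inner)
  have "N\<^sup>2 = - 2 * (y \<bullet> (x - y))"
    unfolding N_def power2_norm_eq_inner
    by (simp add: inner_diff_left inner_diff_right inner_commute xx)
  moreover have "y \<bullet> e = (y \<bullet> (x - y)) / N"
    unfolding e_def inner_scaleR_right by simp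
  \<comment> \<open>So \<open>x\<close> is the mirror image of \<open>y\<close>, and
    \<open>x' + y\<close> lies in the half space of every plane with \<open>0 < a\<close>.\<close>
  ultimately have "y \<bullet> e = - N / 2"
    using N by (simp add: power2_eq_square nonzero_divide_eq_eq)
  moreover have "x' \<bullet> e = 0"
    using eZ x' by (simp add: orthogonal_comp_def orthogonal_def)
  ultimately have ye: "(x' + y) \<bullet> e = - N / 2" by (simp add: inner_add_left)
  have "y \<noteq> 0" using nz eq by auto
  have le: "u (x' + x + (2 * a) *\<^sub>R e) \<le> u (x' + y)" if "0 < a" for a
  proof -
    have eq: "x' + y + (2 * (a - (x' + y) \<bullet> e)) *\<^sub>R e = x' + x + (2 * a) *\<^sub>R e"
    proof -
      have "N *\<^sub>R e = x - y" using N by (simp add: e_def)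
      then show ?thesis unfolding ye by (simp add: scaleR_add_left algebra_simps)
    qed
    have "(x' + y) \<bullet> e < a" unfolding ye using N that by linarith
    from plane_comparison[OF Z e eZ x0 that notin[OF x(2) \<open>y \<noteq> 0\<close>] this] show ?thesis
      unfolding eq .
  qed
  have "((\<lambda>a. x' + x + (2 * a) *\<^sub>R e) \<longlongrightarrow> x' + x + (2 * 0) *\<^sub>R e) (at_right 0)"
    by (intro tendsto_intros)
  then have "((\<lambda>a. x' + x + (2 * a) *\<^sub>R e) \<longlongrightarrow> x' + x) (at_right 0)"
    by simp
  from isCont_tendsto_compose[OF isCont_u[OF notin[OF x(1) nz]] this] show ?thesis
    by (rule tendsto_upperbound) (auto simp: eventually_at_right_less le intro: eventually_at_rightI[of 0 1])
qed simp

lemma symmetric: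
  assumes "subspace Z" "x0 \<in> Z" "singular_at x0" "x' \<in> Z"
    "x \<in> orthogonal_comp Z" "y \<in> orthogonal_comp Z" "x \<noteq> 0" "norm x = norm y"
  shows "u (x' + x) = u (x' + y)"
proof (rule antisym)
  show "u (x' + x) \<le> u (x' + y)" by (rule symmetric_le[OF assms])
  have "y \<noteq> 0" using assms(7,8) by auto
  then show "u (x' + y) \<le> u (x' + x)"
    by (rule symmetric_le[OF assms(1-4,6,5)]) (use assms(8) in simp)
qed

text \<open>The integral is cut at a small sphere about 0: \<open>u\<close> is bounded inside, and
  outside the kernel stays away from its singularity. Both parts converge along every sequence
  tending to 0. The limit is the integral at 0, which is bounded by \<open>M\<close> and positive
  because \<open>u\<close> is.\<close>

lemma removable_singularity:
  assumes Z: "Z = {0}" and not_singular: "\<not> singular_at 0"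
  obtains c where "0 < c" "(u \<longlongrightarrow> c) (at 0)"
    "(\<integral>\<^sup>+y. ennreal (u y powr p * norm (0 - y) powr (- \<alpha>)) \<partial>lborel) = ennreal c"
proof -
  obtain M \<rho> where "0 < \<rho>" and "\<forall>w. w = 0 \<or> \<rho> \<le> norm w \<or> u w \<le> M"
    using not_singular unfolding singular_at_def by (auto simp: not_less Z)
  then have M: "u w \<le> M" if "w \<noteq> 0" "norm w < \<rho>" for w
    using that by (metis not_less)
  obtain \<rho>' where "0 < \<rho>'" and fin:
    "(\<integral>\<^sup>+z. ennreal (norm (z :: 'a) powr (- \<alpha>)) * indicator (ball 0 \<rho>') z \<partial>lborel) < \<infinity>"
    by (rule kernel_locally_integrable)
  \<comment> \<open>Then \<open>norm (X n) < r / 2\<close> and \<open>norm (X n - w) < r\<close>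
    imply \<open>norm w < \<rho>'\<close>, and the bound \<open>M\<close> holds on the ball of
    radius \<open>r\<close>.\<close>
  define r where "r = min \<rho> \<rho>' / 2"
  have r: "0 < r" "r < \<rho>" "2 * r \<le> \<rho>'"
    using \<open>0 < \<rho>\<close> \<open>0 < \<rho>'\<close> by (auto simp: r_def min_def field_simps)
  let ?k = "\<lambda>z :: 'a. norm z powr (- \<alpha>)"
  \<comment> \<open>The substitution \<open>w = x - y\<close> fixes the singular kernel and moves
    the dependence on \<open>x\<close> into the bounded factor, so one majorant serves all
    \<open>x\<close>.\<close>
  let ?near = "\<lambda>x. \<integral>\<^sup>+w. ennreal (u (x - w) powr p * ?k w) * indicator (ball 0 r) (x - w) \<partial>lborel"
  let ?far = "\<lambda>x. \<integral>\<^sup>+y. ennreal (u y powr p * ?k (x - y)) * indicator (- ball 0 r) y \<partial>lborel"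
  have split: "(\<integral>\<^sup>+y. ennreal (u y powr p * ?k (x - y)) \<partial>lborel) = ?near x + ?far x" for x
  proof -
    have "(\<integral>\<^sup>+y. ennreal (u y powr p * ?k (x - y)) \<partial>lborel)
        = (\<integral>\<^sup>+y. ennreal (u y powr p * ?k (x - y)) * indicator (ball 0 r) y
            + ennreal (u y powr p * ?k (x - y)) * indicator (- ball 0 r) y \<partial>lborel)"
      by (intro nn_integral_cong) (auto simp: indicator_def)
    also have "\<dots> = (\<integral>\<^sup>+y. ennreal (u y powr p * ?k (x - y)) * indicator (ball 0 r) y \<partial>lborel) + ?far x"
      by (rule nn_integral_add) measurable
    also have "(\<integral>\<^sup>+y. ennreal (u y powr p * ?k (x - y)) * indicator (ball 0 r) y \<partial>lborel) = ?near x"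
      using nn_integral_lborel_diff[of "\<lambda>y. ennreal (u y powr p * ?k (x - y)) * indicator (ball 0 r) y" x]
      by simp
    finally show ?thesis .
  qed
  define I where "I = (\<integral>\<^sup>+y. ennreal (u y powr p * ?k (0 - y)) \<partial>lborel)"
  have lim: "(\<lambda>n. ennreal (u (X n))) \<longlonglongrightarrow> I"
    if X: "X \<longlonglongrightarrow> 0" and Xr: "\<And>n. X n \<in> ball 0 (r / 2) - {0}" for X
  proof -
    have Xn: "norm (X n) < r / 2" "X n \<noteq> 0" for n using Xr[of n] by auto
    have "(\<lambda>n. ?near (X n)) \<longlonglongrightarrow> ?near 0"
    proof (rule nn_integral_dominated_convergence)
      show "AE w in lborel. ennreal (u (X n - w) powr p * ?k w) * indicator (ball 0 r) (X n - w)
          \<le> ennreal (M powr p) * (ennreal (?k w) * indicator (ball 0 \<rho>') w)" for n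
        using AE_lborel_singleton[of "X n"]
      proof eventually_elim
        case (elim w)
        show ?case
        proof (cases "norm (X n - w) < r")
          case True
          have "norm w \<le> norm (X n) + norm (X n - w)"
            using norm_triangle_ineq4[of "X n" "X n - w"] by simp
          then have "norm w < \<rho>'" using True Xn(1)[of n] r by linarith
          moreover have "u (X n - w) powr p \<le> M powr p"
            using M[of "X n - w"] True r elim p_gt_1 u_nonneg by (intro powr_mono2) auto
          ultimately show ?thesis
            using True by (auto simp: ennreal_mult'[symmetric] intro!: ennreal_leI mult_right_mono)
        qed simp
      qed
      show "(\<integral>\<^sup>+w. ennreal (M powr p) * (ennreal (?k w) * indicator (ball 0 \<rho>') w) \<partial>lborel) < \<infinity>"
        using fin by (subst nn_integral_cmult) (auto simp: ennreal_mult_less_top)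
      have "AE w in lborel. norm (w :: 'a) \<noteq> 0" "AE w in lborel. norm (w :: 'a) \<noteq> r"
        by (rule AE_lborel_norm_neq)+
      then show "AE w in lborel. (\<lambda>n. ennreal (u (X n - w) powr p * ?k w) * indicator (ball 0 r) (X n - w))
          \<longlonglongrightarrow> ennreal (u (0 - w) powr p * ?k w) * indicator (ball 0 r) (0 - w)"
      proof eventually_elim
        case (elim w)
        have lim: "(\<lambda>n. X n - w) \<longlonglongrightarrow> 0 - w" by (intro tendsto_intros X)
        have norm_lim: "(\<lambda>n. norm (X n - w)) \<longlonglongrightarrow> norm w"
          using tendsto_norm[OF lim] by simp
        show ?case
        proof (cases "norm w < r")
          case True
          have "0 - w \<notin> Z" using elim by (simp add: Z)
          then have "(\<lambda>n. ennreal (u (X n - w) powr p * ?k w)) \<longlonglongrightarrow> ennreal (u (0 - w) powr p * ?k w)"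
            using u_pos[of "0 - w"]
            by (intro tendsto_ennrealI tendsto_mult tendsto_powr tendsto_const
                isCont_tendsto_compose[OF isCont_u lim]) auto
          moreover have "\<forall>\<^sub>F n in sequentially. ennreal (u (X n - w) powr p * ?k w)
             = ennreal (u (X n - w) powr p * ?k w) * indicator (ball 0 r) (X n - w)"
            using order_tendstoD(2)[OF norm_lim True] by eventually_elim simp
          ultimately show ?thesis
            using True by (simp add: tendsto_cong)
        next
          case False
          then have "r < norm w" using elim by simp
          from order_tendstoD(1)[OF norm_lim this]
          have "\<forall>\<^sub>F n in sequentially. ennreal (u (X n - w) powr p * ?k w) * indicator (ball 0 r) (X n - w) = 0"
            by eventually_elim simp
          then show ?thesis using False by (simp add: tendsto_eventually)
        qed
      qed
    qed auto
    moreover have "(\<lambda>n. ?far (X n)) \<longlonglongrightarrow> ?far 0"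
    proof (rule nn_integral_dominated_convergence)
      \<comment> \<open>The majorant is the integrand at the first point of the sequence, integrable
        by the equation itself. For \<open>norm y \<ge> r\<close> and points within
        \<open>r / 2\<close> of 0 the distances to \<open>y\<close> differ at most by the factor 3,
        so 4 suffices.\<close>
      let ?x = "X 0"
      show "AE y in lborel. ennreal (u y powr p * ?k (X n - y)) * indicator (- ball 0 r) y
          \<le> ennreal (4 powr \<alpha>) * ennreal (u y powr p * ?k (?x - y))" for n
      proof (rule AE_I2)
        fix y
        show "ennreal (u y powr p * ?k (X n - y)) * indicator (- ball 0 r) y
          \<le> ennreal (4 powr \<alpha>) * ennreal (u y powr p * ?k (?x - y))"
        proof (cases "norm y < r")
          case False
          have 1: "norm y \<le> norm (X n) + norm (X n - y)"
            using norm_triangle_ineq4[of "X n" "X n - y"] by simp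
          have 2: "norm (?x - y) \<le> norm ?x + norm y" by (rule norm_triangle_ineq4)
          have 3: "norm y \<le> norm ?x + norm (?x - y)"
            using norm_triangle_ineq4[of ?x "?x - y"] by simp
          have "0 < norm (?x - y) / 4" "norm (?x - y) / 4 \<le> norm (X n - y)"
            using 1 2 3 False Xn(1)[of n] Xn(1)[of 0] r by linarith+
          then have "?k (X n - y) \<le> (norm (?x - y) / 4) powr (- \<alpha>)"
            using alpha by (intro powr_mono2') auto
          also have "\<dots> = 4 powr \<alpha> * ?k (?x - y)"
            by (simp add: powr_divide powr_minus divide_simps)
          finally have "u y powr p * ?k (X n - y) \<le> 4 powr \<alpha> * (u y powr p * ?k (?x - y))"
            by (subst mult.left_commute) (intro mult_left_mono, auto)
          then show ?thesis
            using False by (simp add: ennreal_mult'[symmetric] ennreal_leI)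
        qed simp
      qed
      show "(\<integral>\<^sup>+y. ennreal (4 powr \<alpha>) * ennreal (u y powr p * ?k (?x - y)) \<partial>lborel) < \<infinity>"
        using solution[of ?x] Xn(2)[of 0]
        by (subst nn_integral_cmult) (auto simp: Z ennreal_mult_less_top)
      show "AE y in lborel. (\<lambda>n. ennreal (u y powr p * ?k (X n - y)) * indicator (- ball 0 r) y)
          \<longlonglongrightarrow> ennreal (u y powr p * ?k (0 - y)) * indicator (- ball 0 r) y"
        using AE_lborel_norm_neq[of 0]
      proof eventually_elim
        case (elim y)
        have "(\<lambda>n. ennreal (u y powr p * ?k (X n - y))) \<longlonglongrightarrow> ennreal (u y powr p * ?k (0 - y))"
          by (intro tendsto_ennrealI tendsto_intros X) (use elim in auto)
        then show ?case
          by (cases "y \<in> ball 0 r") (simp_all add: indicator_def)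
      qed
    qed auto
    ultimately have "(\<lambda>n. ?near (X n) + ?far (X n)) \<longlonglongrightarrow> ?near 0 + ?far 0"
      by (rule tendsto_add)
    moreover have "?near (X n) + ?far (X n) = ennreal (u (X n))" for n
      using split[of "X n"] solution[of "X n"] Xn(2)[of n] by (simp add: Z)
    ultimately show ?thesis
      unfolding I_def split by simp
  qed
  have "I \<le> ennreal M"
  proof -
    obtain b :: 'a where b: "b \<in> Basis" using nonempty_Basis by blast
    \<comment> \<open>A concrete sequence in the punctured ball, through which \<open>I\<close>
      inherits the bound \<open>M\<close>.\<close>
    define X where "X n = (r / 3 / real (Suc n)) *\<^sub>R b" for n
    have "(\<lambda>n. (r / 3 / real (Suc n)) *\<^sub>R b) \<longlonglongrightarrow> 0 *\<^sub>R b"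
      by (intro tendsto_intros LIMSEQ_Suc lim_const_over_n)
    then have X0: "X \<longlonglongrightarrow> 0" by (simp add: X_def[abs_def])
    have nX: "norm (X n) = r / 3 / real (Suc n)" for n
      using b r by (simp add: X_def)
    have X: "norm (X n) < r / 2" "X n \<noteq> 0" for n
    proof -
      have "norm (X n) \<le> r / 3"
        unfolding nX using r by (simp add: field_simps)
      then show "norm (X n) < r / 2" using r by linarith
      have "0 < norm (X n)" unfolding nX using r by simp
      then show "X n \<noteq> 0" by simp
    qed
    have "(\<lambda>n. ennreal (u (X n))) \<longlonglongrightarrow> I"
      by (rule lim[OF X0]) (use X in auto)
    then show ?thesis
    proof (rule tendsto_upperbound)
      have "u (X n) \<le> M" for n
        using X[of n] r by (intro M) auto
      then show "\<forall>\<^sub>F n in sequentially. ennreal (u (X n)) \<le> ennreal M"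
        by (intro always_eventually allI ennreal_leI)
    qed simp
  qed
  then have "I < top" using ennreal_less_top le_less_trans by blast
  then obtain c where c: "I = ennreal c" "0 \<le> c"
    by (cases I) auto
  have "c \<noteq> 0"
  proof
    assume "c = 0"
    then have "(\<integral>\<^sup>+y. ennreal (u y powr p * ?k (0 - y)) \<partial>lborel) = 0"
      using c by (simp add: I_def)
    then have "AE y in lborel. ennreal (u y powr p * ?k (0 - y)) = 0"
      by (subst (asm) nn_integral_0_iff_AE) auto
    with AE_lborel_norm_neq[of 0] have "AE y in (lborel :: 'a measure). False"
    proof eventually_elim
      case (elim y)
      then have "0 < u y" using u_pos[of y] by (simp add: Z)
      with elim show ?case by simp
    qed
    then have "ae_filter (lborel :: 'a measure) = bot"
      by (simp add: trivial_limit_def)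
    then show False
      by (simp add: ae_filter_eq_bot_iff)
  qed
  moreover have "(u \<longlongrightarrow> c) (at 0)"
  proof -
    have "(u \<longlongrightarrow> c) (at 0 within ball 0 (r / 2))"
      unfolding tendsto_at_iff_sequentially comp_def
    proof (intro allI impI)
      fix X assume "\<forall>i. X i \<in> ball 0 (r / 2) - {0 :: 'a}" "X \<longlonglongrightarrow> 0"
      then have "(\<lambda>n. ennreal (u (X n))) \<longlonglongrightarrow> ennreal c"
        using lim[of X] unfolding c by blast
      then show "(\<lambda>n. u (X n)) \<longlonglongrightarrow> c"
        by (rule tendsto_ennrealD) (auto simp: u_nonneg c)
    qed
    then show ?thesis
      using r by (subst (asm) at_within_open) auto
  qed
  ultimately show thesis
    using that[of c] c unfolding I_def by simp
qed

end

text \<open>This connects the definition of a solution, a Bochner integral over the complete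
  measure, with the nonnegative Borel integral of the locale. They agree because the integrand is
  nonnegative and changes of \<open>u\<close> on a null set are invisible.\<close>

lemma has_bochner_integral_lebesgue_iff:
  fixes u v :: "'a::euclidean_space \<Rightarrow> real"
  assumes u [measurable]: "u \<in> borel_measurable lebesgue" and v [measurable]: "v \<in> borel_measurable borel"
    and eq: "AE y in lborel. u y = v y" and "0 \<le> c"
  shows "has_bochner_integral lebesgue (\<lambda>y. u y powr p / norm (x - y) powr \<alpha>) c
     \<longleftrightarrow> (\<integral>\<^sup>+y. ennreal (v y powr p * norm (x - y) powr (- \<alpha>)) \<partial>lborel) = ennreal c"
proof -
  let ?U = "\<lambda>y. u y powr p / norm (x - y) powr \<alpha>"
  let ?V = "\<lambda>y. v y powr p * norm (x - y) powr (- \<alpha>)"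
  have norm_meas [measurable]: "(\<lambda>y. norm (x - y)) \<in> borel_measurable lebesgue"
    by (rule measurable_completion) simp
  have U [measurable]: "?U \<in> borel_measurable lebesgue"
    by measurable
  have "AE y in lebesgue. u y = v y"
    by (rule AE_completion[OF eq])
  then have "AE y in lebesgue. ennreal (?U y) = ennreal (?V y)"
    by eventually_elim (simp add: powr_minus divide_inverse)
  then have "(\<integral>\<^sup>+y. ennreal (?U y) \<partial>lebesgue) = (\<integral>\<^sup>+y. ennreal (?V y) \<partial>lebesgue)"
    by (rule nn_integral_cong_AE)
  also have "\<dots> = (\<integral>\<^sup>+y. ennreal (?V y) \<partial>lborel)"
    by (rule nn_integral_completion)
  finally have nn: "(\<integral>\<^sup>+y. ennreal (?U y) \<partial>lebesgue) = (\<integral>\<^sup>+y. ennreal (?V y) \<partial>lborel)" .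
  show ?thesis
  proof
    assume U: "has_bochner_integral lebesgue ?U c"
    then have "(\<integral>\<^sup>+y. ennreal (?U y) \<partial>lebesgue) = ennreal (integral\<^sup>L lebesgue ?U)"
      by (intro nn_integral_eq_integral) (auto intro: integrable.intros)
    then show "(\<integral>\<^sup>+y. ennreal (?V y) \<partial>lborel) = ennreal c"
      using U nn by (simp add: has_bochner_integral_integral_eq)
  next
    assume "(\<integral>\<^sup>+y. ennreal (?V y) \<partial>lborel) = ennreal c"
    then show "has_bochner_integral lebesgue ?U c"
      using nn \<open>0 \<le> c\<close> by (intro has_bochner_integral_nn_integral) auto
  qed
qed

section \<open>Assembly of the theorem\<close>

lemma subspace_null_sets_lborel:
  fixes S :: "'a::euclidean_space set"
  assumes "subspace S" "dim S < DIM('a)"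
  shows "S \<in> null_sets lborel"
proof -
  have "negligible S" using assms(2) by (rule negligible_lowdim)
  moreover have "S \<in> sets borel" using closed_subspace[OF assms(1)] by (rule borel_closed)
  ultimately show ?thesis
    by (simp add: negligible_iff_null_sets null_sets_def)
qed

theorem theorem1p7:
  fixes \<sigma> :: real and k :: nat and S :: "'a::euclidean_space set" and u :: "'a \<Rightarrow> real"
  assumes "0 < \<sigma>" and "\<sigma> < real DIM('a) / 2"
    and "subspace S" and "dim S = k" and "k < DIM('a)"
    and "u \<in> Lp_loc ((real DIM('a) + 2 * \<sigma>) / (real DIM('a) - 2 * \<sigma>))"
    and "continuous_on (- S) u"
    and "positive_solution_on (- S) \<sigma> u"
  shows "((\<exists>x0\<in>S. Limsup (at x0 within - S) (\<lambda>x. ereal (u x)) = \<infinity>) \<longrightarrow>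
            (\<forall>x'\<in>S. \<forall>x''\<in>orthogonal_comp S. \<forall>y''\<in>orthogonal_comp S.
               x'' \<noteq> 0 \<and> norm x'' = norm y'' \<longrightarrow> u (x' + x'') = u (x' + y'')))
       \<and> (k = 0 \<and> \<not> removable_at_origin \<sigma> u \<longrightarrow> radially_decreasing u)"
proof -
  define n where "n = real DIM('a)"
  define \<alpha> where "\<alpha> = n - 2 * \<sigma>"
  define p where "p = (n + 2 * \<sigma>) / \<alpha>"
  \<comment> \<open>Unlike \<open>u\<close>, whose values on \<open>S\<close> are arbitrary, \<open>v\<close> is Borel measurable.\<close>
  define v where "v x = indicator (- S) x * u x" for x
  have v_eq: "v x = u x" if "x \<notin> S" for x
    using that by (simp add: v_def)
  have sol: "0 < u x" "has_bochner_integral lebesgue (\<lambda>y. u y powr p / norm (x - y) powr \<alpha>) (u x)"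
    if "x \<notin> S" for x
    using assms(8) that by (auto simp: positive_solution_on_def n_def \<alpha>_def p_def)
  have closed_S: "closed S" by (rule closed_subspace[OF assms(3)])
  have null_S: "S \<in> null_sets lborel"
    using assms by (intro subspace_null_sets_lborel) auto
  have u_meas: "u \<in> borel_measurable lebesgue"
    using assms(6) by (simp add: Lp_loc_def)
  have v_meas: "v \<in> borel_measurable borel"
    using borel_measurable_continuous_on_indicator[OF _ assms(7)] closed_S
    by (simp add: v_def[abs_def] borel_closed borel_open)
  have AE_eq: "AE x in lborel. u x = v x"
    by (rule AE_I'[OF null_S]) (auto simp: v_def indicator_def)
  interpret integral_equation \<alpha> p S v
  proof
    show "0 < \<alpha>" "\<alpha> < real DIM('a)" "p = (2 * real DIM('a) - \<alpha>) / \<alpha>"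
      using assms(1,2) by (auto simp: \<alpha>_def p_def n_def)
    show "continuous_on (- S) v"
      using assms(7) by (rule continuous_on_eq) (simp add: v_eq)
    show "0 \<le> v x" for x
      using sol(1)[of x] by (auto simp: v_def indicator_def less_imp_le)
    fix x assume x: "x \<notin> S"
    show "0 < v x" using sol(1)[OF x] by (simp add: v_eq[OF x])
    show "(\<integral>\<^sup>+y. ennreal (v y powr p * norm (x - y) powr (- \<alpha>)) \<partial>lborel) = ennreal (v x)"
      unfolding v_eq[OF x]
      using has_bochner_integral_lebesgue_iff[OF u_meas v_meas AE_eq, of "u x" p x \<alpha>] sol[OF x]
      by simp
  qed (use closed_S null_S v_meas in auto)
  note not_mem = add_orthogonal_comp_notin_subspace[OF assms(3)]
  have singular: "singular_at x0" if "Limsup (at x0 within - S) (\<lambda>x. ereal (u x)) = \<infinity>" for x0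
  proof (rule ccontr)
    assume "\<not> singular_at x0"
    then obtain M \<epsilon> where "0 < \<epsilon>" and M: "\<And>w. w \<notin> S \<Longrightarrow> dist w x0 < \<epsilon> \<Longrightarrow> v w \<le> M"
      unfolding singular_at_def by (meson not_less)
    then have "\<forall>\<^sub>F x in at x0 within - S. ereal (u x) \<le> ereal M"
      unfolding eventually_at using v_eq by (intro exI[of _ \<epsilon>]) auto
    from Limsup_bounded[OF this] that show False by simp
  qed
  have "u (x' + x'') = u (x' + y'')"
    if x0: "x0 \<in> S" "Limsup (at x0 within - S) (\<lambda>x. ereal (u x)) = \<infinity>"
      and x: "x' \<in> S" "x'' \<in> orthogonal_comp S" "y'' \<in> orthogonal_comp S" "x'' \<noteq> 0" "norm x'' = norm y''"
    for x0 x' x'' y''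
  proof -
    have "y'' \<noteq> 0" using x(4,5) by auto
    then show ?thesis
      using symmetric[OF assms(3) x0(1) singular[OF x0(2)] x] v_eq not_mem x by metis
  qed
  moreover have "radially_decreasing u" if "k = 0" and nonremovable: "\<not> removable_at_origin \<sigma> u"
  proof -
    have S: "S = {0}"
      using assms(3,4) that(1) subspace_0 by auto
    have "singular_at 0"
    proof (rule ccontr)
      assume "\<not> singular_at 0"
      from removable_singularity[OF S this] obtain c where c: "0 < c" "(v \<longlongrightarrow> c) (at 0)"
        "(\<integral>\<^sup>+y. ennreal (v y powr p * norm (0 - y) powr (- \<alpha>)) \<partial>lborel) = ennreal c"
        by blast
      \<comment> \<open>The value of \<open>u\<close> at 0 is arbitrary; the candidate extension
        takes the limit instead.\<close>
      define w where "w x = (if x = 0 then c else u x)" for x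
      have w_eq: "w x = v x" if "x \<noteq> 0" for x using that v_eq[of x] by (simp add: w_def S)
      have "isCont w x" for x
      proof (cases "x = 0")
        case True
        have "(w \<longlongrightarrow> c) (at 0)"
          using c(2) by (rule Lim_transform_eventually)
            (auto simp: eventually_at_filter w_eq)
        then show ?thesis using True by (simp add: isCont_def w_def)
      next
        case False
        then have "isCont v x" by (intro isCont_u) (simp add: S)
        moreover have "\<forall>\<^sub>F y in nhds x. y \<in> - {0}"
          by (rule eventually_nhds_in_open) (use False in auto)
        then have "\<forall>\<^sub>F y in nhds x. w y = v y"
          by eventually_elim (simp add: w_eq)
        ultimately show ?thesis by (simp add: isCont_cong)
      qed
      then have cont: "continuous_on UNIV w" by (simp add: continuous_on_eq_continuous_at)
      then have w_meas: "w \<in> borel_measurable borel" by (rule borel_measurable_continuous_onI)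
      have "positive_solution_on UNIV \<sigma> w"
        unfolding positive_solution_on_def
      proof (intro ballI conjI)
        fix x
        show pos: "0 < w x"
          using c(1) sol(1)[of x] by (simp add: w_def S)
        have AE_w: "AE y in lborel. w y = v y"
          using AE_lborel_norm_neq[of 0] by eventually_elim (simp add: w_eq)
        have "(\<integral>\<^sup>+y. ennreal (v y powr p * norm (x - y) powr (- \<alpha>)) \<partial>lborel) = ennreal (w x)"
          using c(3) solution[of x] by (cases "x = 0") (simp_all add: S w_eq, simp add: w_def)
        then have "has_bochner_integral lebesgue (\<lambda>y. w y powr p / norm (x - y) powr \<alpha>) (w x)"
          using has_bochner_integral_lebesgue_iff[OF measurable_completion[OF _] v_meas AE_w, of "w x" p x \<alpha>]
            w_meas pos by simp
        then show "has_bochner_integral lebesgue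
          (\<lambda>y. w y powr ((real DIM('a) + 2 * \<sigma>) / (real DIM('a) - 2 * \<sigma>))
                 / norm (x - y) powr (real DIM('a) - 2 * \<sigma>)) (w x)"
          by (simp add: n_def \<alpha>_def p_def)
      qed
      then have "removable_at_origin \<sigma> u"
        unfolding removable_at_origin_def using cont by (intro exI[of _ w]) (simp add: w_def)
      with nonremovable show False ..
    qed
    obtain b :: 'a where "b \<in> Basis" using nonempty_Basis by blast
    then have b: "norm b = 1" by simp
    then have b0: "b \<noteq> 0" "b \<bullet> b = 1" by (auto simp: norm_eq_1)
    have comp: "x \<in> orthogonal_comp S" for x
      by (simp add: S orthogonal_comp_def orthogonal_def)
    have "u x = u (norm x *\<^sub>R b)" if "x \<noteq> 0" for x
      using symmetric[OF assms(3) _ \<open>singular_at 0\<close> _ comp comp that, of 0 "norm x *\<^sub>R b"] b b0 that v_eq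
      by (simp add: S)
    moreover have "antimono_on {0<..} (\<lambda>r. u (r *\<^sub>R b))"
    proof (rule monotone_onI)
      fix r s :: real assume rs: "r \<in> {0<..}" "s \<in> {0<..}" "r \<le> s"
      show "u (s *\<^sub>R b) \<le> u (r *\<^sub>R b)"
      proof (cases "r = s")
        case False
        then have "r < s" using rs by simp
        \<comment> \<open>The plane at offset \<open>(r + s) / 2\<close> lies halfway between the
          two points and reflects one to the other.\<close>
        have "v (r *\<^sub>R b + (2 * ((r + s) / 2 - r *\<^sub>R b \<bullet> b)) *\<^sub>R b) \<le> v (r *\<^sub>R b)"
          by (rule plane_comparison[OF assms(3) b comp _ \<open>singular_at 0\<close>])
             (use rs \<open>r < s\<close> b0 in \<open>auto simp: S\<close>)
        also have "r *\<^sub>R b + (2 * ((r + s) / 2 - r *\<^sub>R b \<bullet> b)) *\<^sub>R b = s *\<^sub>R b"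
          using b0 by (simp flip: scaleR_add_left add: field_simps)
        finally show ?thesis using rs b0 v_eq by (simp add: S)
      qed simp
    qed
    ultimately show ?thesis
      unfolding radially_decreasing_def by (intro exI[of _ "\<lambda>r. u (r *\<^sub>R b)"] conjI allI impI)
  qed
  ultimately show ?thesis by blast
qed

end
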